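(* Let $\Delta$ be a thick semi-regular right-angled building. Let $c_0$ be a chamber of $\Delta$ and let $n\in\mathbb{N}$. Let $K=\mathrm{Fix}_{\mathrm{Aut}(\Delta)}(\mathsf{B}(c_0,n))$ be the pointwise stabilizer in $\mathrm{Aut}(\Delta)$ of the ball $\mathsf{B}(c_0,n)$. Then the fixed-point set $\Delta^K$ (the set of chambers of $\Delta$ fixed by every element of $K$) is equal to $\mathrm{Flex}(c_0,n)$, and this set is bounded (for the gallery distance).
   Context: A Coxeter system $(W,S)$ ($S$ finite) is right-angled if all entries of its Coxeter matrix are $1,2$ or $\infty$; $l$ is the word length on $W$. A chamber system with index set $S$ is an edge-colored graph with color set $S$ such that for each $s\in S$ every $s$-panel (connected component of the graph formed by the edges of color $s$) is a complete graph with at least two vertices; vertices are called chambers. A right-angled building of type $(W,S)$ is a chamber system $\Delta$ with index set $S$ together with a map (Weyl distance) $\delta\colon \mathrm{Ch}(\Delta)\times\mathrm{Ch}(\Delta)\to W$, where $(W,S)$ is a right-angled Coxeter system, such that for every reduced word $w$ representing $\overline{w}\in W$: $\delta(c_1,c_2)=\overline{w}$ iff there is a gallery (path) of type $w$ (sequence of colors) from $c_1$ to $c_2$. It is thick if every panel has at least three chambers, and semi-regular if for each $s\in S$ all $s$-panels have the same cardinality. $\mathrm{Aut}(\Delta)$ is the group of type-preserving (color-preserving) automorphisms. The gallery distance is $d_W(c_1,c_2)=l(\delta(c_1,c_2))$ and $\mathsf{B}(c_0,n)$ is the set of chambers at gallery distance at most $n$ from $c_0$. An element $w\in W$ is firm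 if every reduced word representing it ends with the same letter; equivalently there is a unique $r\in S$ with $l(wr)<l(w)$. A chamber $c$ is firm with respect to $c_0$ if $\delta(c_0,c)$ is firm. A chamber $c$ at distance $k>n$ from $c_0$ is $n$-flexible with respect to $c_0$ if for each minimal gallery $(c_0,c_1,\dots,c_k=c)$ from $c_0$ to $c$, none of the chambers $c_{n+1},\dots,c_k$ is firm with respect to $c_0$; by convention all chambers of $\mathsf{B}(c_0,n)$ are $n$-flexible. $\mathrm{Flex}(c_0,n)$ is the set of all chambers that are $n$-flexible with respect to $c_0$. *)

theory Defs
  imports "HOL-Algebra.Algebra" "HOL-Library.Extended_Nat" "HOL-Library.Equipollence"
begin

section \<open>Coxeter systems\<close>

text \<open>A word over \<open>S\<close> is an element of \<^term>\<open>lists S\<close>.\<close>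

definition word_prod :: "('w, 'x) monoid_scheme \<Rightarrow> 'w list \<Rightarrow> 'w" where
  "word_prod W ws = foldr (\<otimes>\<^bsub>W\<^esub>) ws \<one>\<^bsub>W\<^esub>"

text \<open>The entry for \<open>s\<close>, \<open>t\<close> is the order of \<open>st\<close>; \<^const>\<open>group.ord\<close> encodes infinite order by \<open>0\<close>.\<close>

definition coxeter_matrix :: "('w, 'x) monoid_scheme \<Rightarrow> 'w \<Rightarrow> 'w \<Rightarrow> enat" where
  "coxeter_matrix W s t =
     (if group.ord W (s \<otimes>\<^bsub>W\<^esub> t) = 0 then \<infinity> else enat (group.ord W (s \<otimes>\<^bsub>W\<^esub> t)))"

text \<open>
  The congruence on words generated by the relators \<open>(st)\<^sup>m\<close>, where \<open>m < \<infinity>\<close> is the Coxeter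
  matrix entry of \<open>s\<close>, \<open>t\<close>. For \<open>s = t\<close> the relator is \<open>ss\<close>, so every letter is its own inverse
  and the quotient of the free monoid on \<open>S\<close> by this congruence is the group with presentation
  \<open>\<langle>S | (st)\<^sup>m\<rangle>\<close>.
\<close>

inductive coxeter_equiv :: "('w, 'x) monoid_scheme \<Rightarrow> 'w set \<Rightarrow> 'w list \<Rightarrow> 'w list \<Rightarrow> bool"
  for W :: "('w, 'x) monoid_scheme" and S :: "'w set" where
  relator: "\<lbrakk>us \<in> lists S; vs \<in> lists S; s \<in> S; t \<in> S; coxeter_matrix W s t = enat m\<rbrakk>
    \<Longrightarrow> coxeter_equiv W S (us @ concat (replicate m [s, t]) @ vs) (us @ vs)"
| refl: "us \<in> lists S \<Longrightarrow> coxeter_equiv W S us us"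
| sym: "coxeter_equiv W S us vs \<Longrightarrow> coxeter_equiv W S vs us"
| trans: "\<lbrakk>coxeter_equiv W S us vs; coxeter_equiv W S vs ws\<rbrakk> \<Longrightarrow> coxeter_equiv W S us ws"

definition coxeter_system :: "('w, 'x) monoid_scheme \<Rightarrow> 'w set \<Rightarrow> bool" where
  "coxeter_system W S \<longleftrightarrow>
     group W \<and> finite S \<and> S \<subseteq> carrier W \<and> generate W S = carrier W \<and>
     (\<forall>s\<in>S. group.ord W s = 2) \<and>
     (\<forall>us\<in>lists S. \<forall>vs\<in>lists S. word_prod W us = word_prod W vs \<longleftrightarrow> coxeter_equiv W S us vs)"

definition right_angled_coxeter_system :: "('w, 'x) monoid_scheme \<Rightarrow> 'w set \<Rightarrow> bool" where
  "right_angled_coxeter_system W S \<longleftrightarrow>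
     coxeter_system W S \<and> (\<forall>s\<in>S. \<forall>t\<in>S. coxeter_matrix W s t \<in> {1, 2, \<infinity>})"

definition word_length :: "('w, 'x) monoid_scheme \<Rightarrow> 'w set \<Rightarrow> 'w \<Rightarrow> nat" where
  "word_length W S w = (LEAST k. \<exists>ws\<in>lists S. word_prod W ws = w \<and> length ws = k)"

definition reduced_word :: "('w, 'x) monoid_scheme \<Rightarrow> 'w set \<Rightarrow> 'w list \<Rightarrow> bool" where
  "reduced_word W S ws \<longleftrightarrow> ws \<in> lists S \<and> length ws = word_length W S (word_prod W ws)"

text \<open>The identity element, whose only reduced word has no last letter, is not firm.\<close>

definition firm :: "('w, 'x) monoid_scheme \<Rightarrow> 'w set \<Rightarrow> 'w \<Rightarrow> bool" where
  "firm W S w \<longleftrightarrow>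
     (\<exists>r\<in>S. \<forall>ws. reduced_word W S ws \<and> word_prod W ws = w \<longrightarrow> ws \<noteq> [] \<and> last ws = r)"


section \<open>Chamber systems and right-angled buildings\<close>

text \<open>The value of \<open>colour\<close> is relevant only on \<open>edges\<close>.\<close>

record ('c, 's) coloured_graph =
  chambers :: "'c set"
  edges :: "'c set set"
  colour :: "'c set \<Rightarrow> 's"

definition adjacent :: "('c, 's) coloured_graph \<Rightarrow> 's \<Rightarrow> 'c \<Rightarrow> 'c \<Rightarrow> bool" where
  "adjacent \<Delta> s c d \<longleftrightarrow> {c, d} \<in> edges \<Delta> \<and> colour \<Delta> {c, d} = s"

definition panels :: "('c, 's) coloured_graph \<Rightarrow> 's \<Rightarrow> 'c set set" where
  "panels \<Delta> s = {{d. (adjacent \<Delta> s)\<^sup>*\<^sup>* c d} |c. c \<in> chambers \<Delta>}"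

definition chamber_system :: "'s set \<Rightarrow> ('c, 's) coloured_graph \<Rightarrow> bool" where
  "chamber_system S \<Delta> \<longleftrightarrow>
     (\<forall>e\<in>edges \<Delta>. e \<subseteq> chambers \<Delta> \<and> card e = 2 \<and> colour \<Delta> e \<in> S) \<and>
     (\<forall>s\<in>S. \<forall>P\<in>panels \<Delta> s.
        (\<forall>c\<in>P. \<forall>d\<in>P. c \<noteq> d \<longrightarrow> adjacent \<Delta> s c d) \<and> (\<exists>c\<in>P. \<exists>d\<in>P. c \<noteq> d))"

text \<open>A gallery is given by its list \<open>[c\<^sub>0, \<dots>, c\<^sub>k]\<close> of chambers, hence by a list of length \<open>k + 1\<close>.\<close>

definition gallery_of_type ::
  "('c, 's) coloured_graph \<Rightarrow> 's list \<Rightarrow> 'c \<Rightarrow> 'c \<Rightarrow> 'c list \<Rightarrow> bool" where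
  "gallery_of_type \<Delta> ws c d cs \<longleftrightarrow>
     length cs = Suc (length ws) \<and> set cs \<subseteq> chambers \<Delta> \<and> hd cs = c \<and> last cs = d \<and>
     (\<forall>i<length ws. adjacent \<Delta> (ws ! i) (cs ! i) (cs ! Suc i))"

definition gallery :: "('c, 's) coloured_graph \<Rightarrow> 'c \<Rightarrow> 'c \<Rightarrow> 'c list \<Rightarrow> bool" where
  "gallery \<Delta> c d cs \<longleftrightarrow> (\<exists>ws. gallery_of_type \<Delta> ws c d cs)"

definition minimal_gallery :: "('c, 's) coloured_graph \<Rightarrow> 'c \<Rightarrow> 'c \<Rightarrow> 'c list \<Rightarrow> bool" where
  "minimal_gallery \<Delta> c d cs \<longleftrightarrow>
     gallery \<Delta> c d cs \<and> (\<forall>cs'. gallery \<Delta> c d cs' \<longrightarrow> length cs \<le> length cs')"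

definition right_angled_building ::
  "('w, 'x) monoid_scheme \<Rightarrow> 'w set \<Rightarrow> ('c, 'w) coloured_graph \<Rightarrow> ('c \<Rightarrow> 'c \<Rightarrow> 'w) \<Rightarrow> bool" where
  "right_angled_building W S \<Delta> \<delta> \<longleftrightarrow>
     right_angled_coxeter_system W S \<and> chamber_system S \<Delta> \<and>
     (\<forall>c\<in>chambers \<Delta>. \<forall>d\<in>chambers \<Delta>. \<delta> c d \<in> carrier W) \<and>
     (\<forall>ws. reduced_word W S ws \<longrightarrow>
        (\<forall>c\<in>chambers \<Delta>. \<forall>d\<in>chambers \<Delta>.
           \<delta> c d = word_prod W ws \<longleftrightarrow> (\<exists>cs. gallery_of_type \<Delta> ws c d cs)))"

definition thick :: "'s set \<Rightarrow> ('c, 's) coloured_graph \<Rightarrow> bool" where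
  "thick S \<Delta> \<longleftrightarrow>
     (\<forall>s\<in>S. \<forall>P\<in>panels \<Delta> s. \<exists>c\<in>P. \<exists>d\<in>P. \<exists>e\<in>P. c \<noteq> d \<and> c \<noteq> e \<and> d \<noteq> e)"

definition semi_regular :: "'s set \<Rightarrow> ('c, 's) coloured_graph \<Rightarrow> bool" where
  "semi_regular S \<Delta> \<longleftrightarrow> (\<forall>s\<in>S. \<forall>P\<in>panels \<Delta> s. \<forall>Q\<in>panels \<Delta> s. P \<approx> Q)"


section \<open>Automorphisms, balls and flexible chambers\<close>

definition Aut :: "('c, 's) coloured_graph \<Rightarrow> ('c \<Rightarrow> 'c) set" where
  "Aut \<Delta> = {g \<in> Bij (chambers \<Delta>). \<forall>c\<in>chambers \<Delta>. \<forall>d\<in>chambers \<Delta>. \<forall>s.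
     adjacent \<Delta> s (g c) (g d) \<longleftrightarrow> adjacent \<Delta> s c d}"

definition pointwise_stabilizer :: "('c \<Rightarrow> 'c) set \<Rightarrow> 'c set \<Rightarrow> ('c \<Rightarrow> 'c) set" where
  "pointwise_stabilizer G B = {g \<in> G. \<forall>c\<in>B. g c = c}"

definition fixed_chambers :: "('c, 's) coloured_graph \<Rightarrow> ('c \<Rightarrow> 'c) set \<Rightarrow> 'c set" where
  "fixed_chambers \<Delta> K = {c \<in> chambers \<Delta>. \<forall>g\<in>K. g c = c}"

definition gallery_dist ::
  "('w, 'x) monoid_scheme \<Rightarrow> 'w set \<Rightarrow> ('c \<Rightarrow> 'c \<Rightarrow> 'w) \<Rightarrow> 'c \<Rightarrow> 'c \<Rightarrow> nat" where
  "gallery_dist W S \<delta> c d = word_length W S (\<delta> c d)"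

definition chamber_ball ::
  "('w, 'x) monoid_scheme \<Rightarrow> 'w set \<Rightarrow> ('c, 'w) coloured_graph \<Rightarrow> ('c \<Rightarrow> 'c \<Rightarrow> 'w) \<Rightarrow>
     'c \<Rightarrow> nat \<Rightarrow> 'c set" where
  "chamber_ball W S \<Delta> \<delta> c0 n = {c \<in> chambers \<Delta>. gallery_dist W S \<delta> c0 c \<le> n}"

definition Flex ::
  "('w, 'x) monoid_scheme \<Rightarrow> 'w set \<Rightarrow> ('c, 'w) coloured_graph \<Rightarrow> ('c \<Rightarrow> 'c \<Rightarrow> 'w) \<Rightarrow>
     'c \<Rightarrow> nat \<Rightarrow> 'c set" where
  "Flex W S \<Delta> \<delta> c0 n =
     chamber_ball W S \<Delta> \<delta> c0 n \<union>
     {c \<in> chambers \<Delta>. n < gallery_dist W S \<delta> c0 c \<and>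
        (\<forall>cs. minimal_gallery \<Delta> c0 c cs \<longrightarrow>
           (\<forall>i. n < i \<and> i < length cs \<longrightarrow> \<not> firm W S (\<delta> c0 (cs ! i))))}"

definition bounded_chambers ::
  "('w, 'x) monoid_scheme \<Rightarrow> 'w set \<Rightarrow> ('c \<Rightarrow> 'c \<Rightarrow> 'w) \<Rightarrow> 'c set \<Rightarrow> bool" where
  "bounded_chambers W S \<delta> A \<longleftrightarrow> (\<exists>N. \<forall>c\<in>A. \<forall>d\<in>A. gallery_dist W S \<delta> c d \<le> N)"

end

theory Submission
  imports Defs
begin

text \<open>
  A chamber \<open>c\<close> is described by the element \<open>\<delta> c0 c\<close> of the Coxeter group. A letter \<open>s\<close> is a
  \<^emph>\<open>descent\<close> of an element \<open>w\<close> if \<open>ws\<close> is shorter than \<open>w\<close>; firm means that there is exactly one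
  descent. Every \<open>s\<close>-panel has one chamber closest to \<open>c0\<close>, its \<^emph>\<open>gate\<close>, and the chambers of the panel
  other than the gate are those with descent \<open>s\<close>.

  \<^emph>\<open>Flexible chambers are fixed.\<close> A flexible chamber outside the ball is not firm, so it has two
  descents \<open>s \<noteq> t\<close>. The gates of its \<open>s\<close>-panel and its \<open>t\<close>-panel are again flexible and closer to
  \<open>c0\<close>, hence fixed by induction. So the stabilizer preserves both panels, and these meet in a single
  chamber (\<open>flexible_fixed\<close>).

  \<^emph>\<open>Other chambers are moved.\<close> Suppose that a minimal gallery from \<open>c0\<close> to \<open>c\<close> passes through a firm
  chamber \<open>e\<close> outside the ball, with descent \<open>r\<close>. It suffices to find an automorphism that fixes all
  chambers closer to \<open>c0\<close> than \<open>e\<close> and moves \<open>e\<close>, because the fixed chambers of such an automorphism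
  are closed under going back along minimal galleries (\<open>fixed_downward_closed\<close>).

  Automorphisms come from coordinates. By semi-regularity the chambers of all \<open>s\<close>-panels can be
  coloured bijectively by one set of colours, so that gates receive a fixed colour and the colour does
  not change along letters that commute with \<open>s\<close> (\<open>wall_colouring_exists\<close>). Recording the colours of
  the successive steps of a minimal gallery then identifies chambers with coloured reduced words up to
  commutation. Two such colourings therefore differ by an automorphism of the building
  (\<open>recolouring_automorphism\<close>). For the second colouring, swap two colours of the first one, for the
  letter \<open>r\<close> and only in the residue of \<open>e\<close> whose type consists of \<open>r\<close> and the letters commuting with
  \<open>r\<close>. Thickness provides a colour, different from those of \<open>e\<close> and of the gates, to swap with that of
  \<open>e\<close>. Since \<open>e\<close> is firm, no chamber of this residue with descent \<open>r\<close> is closer to \<open>c0\<close> than \<open>e\<close>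
  (\<open>firm_minimal_in_wall_residue\<close>), so chambers closer to \<open>c0\<close> do not notice the swap.

  \<^emph>\<open>Boundedness\<close> is a property of the Coxeter group: if some letter occurs more than \<open>n\<close> times in a
  reduced word, then the word can be rearranged to have a firm prefix longer than \<open>n\<close>. So flexible
  chambers have distance at most \<open>n |S|\<close> from \<open>c0\<close> (\<open>flexible_near_base\<close>).

  The facts on Coxeter groups rest on inversion sets and the exchange condition. Specific to the
  right-angled case are that the exchange condition deletes the very letter that is appended, and that
  any two descents of an element commute.
\<close>

section \<open>Words and lengths in right-angled Coxeter groups\<close>

locale ra_coxeter =
  fixes W :: "('w, 'x) monoid_scheme" (structure) and S :: "'w set"
  assumes right_angled: "right_angled_coxeter_system W S"
begin

lemma group_W: "group W" and finite_S: "finite S" and S_carrier: "S \<subseteq> carrier W"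
  and generate_S: "generate W S = carrier W"
  and ord_S: "s \<in> S \<Longrightarrow> group.ord W s = 2"
  and presentation: "us \<in> lists S \<Longrightarrow> vs \<in> lists S \<Longrightarrow>
     word_prod W us = word_prod W vs \<longleftrightarrow> coxeter_equiv W S us vs"
  and matrix_entry: "s \<in> S \<Longrightarrow> t \<in> S \<Longrightarrow> coxeter_matrix W s t \<in> {1, 2, \<infinity>}"
  using right_angled
  unfolding right_angled_coxeter_system_def coxeter_system_def by auto

end

sublocale ra_coxeter \<subseteq> group W
  by (rule group_W)

context ra_coxeter
begin

declare in_lists_conv_set [simp]

abbreviation wprod :: "'w list \<Rightarrow> 'w" where "wprod \<equiv> word_prod W"
abbreviation len :: "'w \<Rightarrow> nat" where "len \<equiv> word_length W S"
abbreviation reduced :: "'w list \<Rightarrow> bool" where "reduced \<equiv> reduced_word W S"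

definition descent :: "'w \<Rightarrow> 'w \<Rightarrow> bool" where
  "descent w s \<longleftrightarrow> s \<in> S \<and> len (w \<otimes> s) < len w"

lemma letter_closed [simp, intro]: "s \<in> S \<Longrightarrow> s \<in> carrier W"
  using S_carrier by auto

lemma letter_square [simp]: "s \<in> S \<Longrightarrow> s \<otimes> s = \<one>"
  using pow_ord_eq_1[of s] ord_S[of s] by (simp add: numeral_2_eq_2)

lemma letter_cancel [simp]:
  "s \<in> S \<Longrightarrow> x \<in> carrier W \<Longrightarrow> s \<otimes> (s \<otimes> x) = x"
  "s \<in> S \<Longrightarrow> x \<in> carrier W \<Longrightarrow> x \<otimes> s \<otimes> s = x"
  by (simp_all add: m_assoc[symmetric]) (simp add: m_assoc)

lemma wprod_Nil [simp]: "wprod [] = \<one>"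
  by (simp add: word_prod_def)

lemma wprod_Cons [simp]: "wprod (s # u) = s \<otimes> wprod u"
  by (simp add: word_prod_def)

lemma wprod_closed [simp, intro]: "u \<in> lists S \<Longrightarrow> wprod u \<in> carrier W"
  by (induction u) auto

lemma wprod_append [simp]:
  "u \<in> lists S \<Longrightarrow> v \<in> lists S \<Longrightarrow> wprod (u @ v) = wprod u \<otimes> wprod v"
  by (induction u) (auto simp: m_assoc)

lemma wprod_surj:
  assumes "w \<in> carrier W" obtains u where "u \<in> lists S" "wprod u = w"
proof -
  have "w \<in> generate W S" using assms generate_S by simp
  then have "\<exists>u\<in>lists S. wprod u = w"
  proof (induction rule: generate.induct)
    case one
    show ?case by (intro bexI[of _ "[]"]) auto
  next
    case (incl s)
    then show ?case by (intro bexI[of _ "[s]"]) auto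
  next
    case (inv s)
    then have "inv s = s" by (intro inv_equality) auto
    with inv show ?case by (intro bexI[of _ "[s]"]) auto
  next
    case (eng x y)
    then obtain u v where "u \<in> lists S" "v \<in> lists S" "wprod u = x" "wprod v = y" by auto
    then show ?case by (intro bexI[of _ "u @ v"]) auto
  qed
  then show ?thesis using that by auto
qed

lemma len_le: "u \<in> lists S \<Longrightarrow> len (wprod u) \<le> length u"
  unfolding word_length_def by (rule Least_le) auto

lemma reduced_exists:
  assumes "w \<in> carrier W" obtains u where "reduced u" "wprod u = w"
proof -
  have "\<exists>k. \<exists>u\<in>lists S. wprod u = w \<and> length u = k" using wprod_surj[OF assms] by metis
  from LeastI_ex[OF this] obtain u where "u \<in> lists S" "wprod u = w" "length u = len w"
    unfolding word_length_def by auto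
  then show ?thesis using that by (auto simp: reduced_word_def)
qed

lemma reduced_letters: "reduced u \<Longrightarrow> u \<in> lists S"
  by (simp add: reduced_word_def)

lemma reduced_length: "reduced u \<Longrightarrow> len (wprod u) = length u"
  by (simp add: reduced_word_def)

lemma reducedI: "u \<in> lists S \<Longrightarrow> length u \<le> len (wprod u) \<Longrightarrow> reduced u"
  using len_le[of u] by (simp add: reduced_word_def)

lemma len_mult_le:
  assumes "w \<in> carrier W" "v \<in> lists S" shows "len (w \<otimes> wprod v) \<le> len w + length v"
proof -
  obtain u where u: "reduced u" "wprod u = w" using reduced_exists[OF assms(1)] .
  have "len (wprod (u @ v)) \<le> length (u @ v)"
    using assms reduced_letters[OF u(1)] by (intro len_le) auto
  then show ?thesis using assms reduced_length[OF u(1)] reduced_letters[OF u(1)] u(2) by simp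
qed

lemma reduced_prefix:
  assumes "reduced (u @ v)" shows "reduced u"
proof -
  have l: "u \<in> lists S" "v \<in> lists S" using reduced_letters[OF assms] by auto
  have "length (u @ v) \<le> len (wprod u) + length v"
    using reduced_length[OF assms] len_mult_le[of "wprod u" v] l by simp
  then show ?thesis using l by (intro reducedI) auto
qed

lemma reduced_Nil: "reduced []" by (rule reducedI) auto

lemma len_one: "len \<one> = 0"
  using len_le[of "[]"] by simp

lemma commuting_if_order_two:
  assumes "s \<in> S" "t \<in> S" "(s \<otimes> t) [^] (2::nat) = \<one>" shows "s \<otimes> t = t \<otimes> s"
proof -
  have "(s \<otimes> t) \<otimes> (s \<otimes> t) = \<one>" using assms by (simp add: numeral_2_eq_2)
  moreover have "(t \<otimes> s) \<otimes> (s \<otimes> t) = \<one>" using assms by (simp add: m_assoc)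
  ultimately show ?thesis using assms by (metis letter_closed m_closed r_cancel)
qed

text \<open>
  The presentation as a universal property. In the right-angled case the relators are \<open>ss\<close> and
  \<open>stst\<close> for commuting \<open>s\<close> and \<open>t\<close>, so it suffices that every letter acts as an involution and
  that commuting letters act by commuting maps. Three different actions are used below: on sets of
  reflections, on parities of letter counts, and on reduced words of an infinite dihedral group.
\<close>

lemma fold_word_invariant:
  assumes closed: "\<And>s a. s \<in> S \<Longrightarrow> a \<in> Q \<Longrightarrow> f s a \<in> Q"
    and involutive: "\<And>s a. s \<in> S \<Longrightarrow> a \<in> Q \<Longrightarrow> f s (f s a) = a"
    and commuting: "\<And>s t a. s \<in> S \<Longrightarrow> t \<in> S \<Longrightarrow> s \<noteq> t \<Longrightarrow> s \<otimes> t = t \<otimes> s \<Longrightarrow> a \<in> Q \<Longrightarrow>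
        f s (f t a) = f t (f s a)"
    and words: "u \<in> lists S" "v \<in> lists S" "wprod u = wprod v" and a: "a \<in> Q"
  shows "fold f u a = fold f v a"
proof -
  have fold_closed: "fold f u a \<in> Q" if "u \<in> lists S" "a \<in> Q" for u a
    using that by (induction u arbitrary: a) (auto simp: closed)
  have "coxeter_equiv W S u v" using words presentation by blast
  then have "\<forall>a\<in>Q. fold f u a = fold f v a"
  proof (induction rule: coxeter_equiv.induct)
    case (relator us vs s t m)
    have "fold f (concat (replicate m [s, t])) a = a" if a: "a \<in> Q" for a
    proof -
      have ord: "group.ord W (s \<otimes> t) = m"
        using relator(5) by (auto simp: coxeter_matrix_def split: if_splits)
      have pow: "(s \<otimes> t) [^] m = \<one>"
        unfolding ord[symmetric] using relator(3,4) by (intro pow_ord_eq_1) auto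
      have "enat m \<in> {1, 2, \<infinity>}" using matrix_entry[OF relator(3,4)] relator(5) by simp
      then have "m = 1 \<or> m = 2"
        by (auto simp: one_enat_def numeral_eq_enat)
      then show ?thesis
      proof
        assume m: "m = 1"
        then have "s \<otimes> t = t \<otimes> t" using pow relator(3,4) by simp
        then have "s = t" using relator(3,4) by (metis letter_closed r_cancel)
        then show ?thesis using m relator(3) a by (simp add: involutive)
      next
        assume m: "m = 2"
        then have "s \<otimes> t = t \<otimes> s" using pow relator(3,4) by (intro commuting_if_order_two) auto
        then have "f t (f s a) = f s (f t a)"
          using commuting[OF relator(3,4) _ _ a] by (cases "s = t") auto
        then show ?thesis using m relator(3,4) a
          by (simp add: numeral_2_eq_2 involutive closed)
      qed
    qed
    then show ?case using fold_closed relator(1) by simp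
  qed auto
  then show ?thesis using a by blast
qed

section \<open>Inversions and the exchange condition\<close>

text \<open>
  The inversion set of a word \<open>s\<^sub>1 \<dots> s\<^sub>k\<close> consists of the elements that occur an odd number of times
  among the reflections \<open>s\<^sub>k \<dots> s\<^sub>i\<^sub>+\<^sub>1 s\<^sub>i s\<^sub>i\<^sub>+\<^sub>1 \<dots> s\<^sub>k\<close>. Appending a letter \<open>s\<close> conjugates
  the earlier reflections by \<open>s\<close> and adds \<open>s\<close>; doing this modulo 2 makes it an action of the
  group, so that the set depends only on the element that the word represents.
\<close>

definition flip_wall :: "'w \<Rightarrow> 'w set \<Rightarrow> 'w set" where
  "flip_wall s A = {x \<in> carrier W. (s \<otimes> x \<otimes> s \<in> A) \<noteq> (x = s)}"

definition inversions :: "'w list \<Rightarrow> 'w set" where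
  "inversions u = fold flip_wall u {}"

lemma inversions_Nil [simp]: "inversions [] = {}"
  and inversions_snoc: "inversions (u @ [s]) = flip_wall s (inversions u)"
  by (simp_all add: inversions_def)

lemma conj_cancel:
  assumes "s \<in> S" "x \<in> carrier W" shows "s \<otimes> (s \<otimes> x \<otimes> s) \<otimes> s = x"
  using assms by (simp add: m_assoc)

lemma conj_eq_iff:
  assumes "s \<in> S" "x \<in> carrier W" "y \<in> carrier W"
  shows "s \<otimes> x \<otimes> s = y \<longleftrightarrow> x = s \<otimes> y \<otimes> s"
  using conj_cancel assms by metis

lemma conj_commuting:
  assumes "s \<in> S" "t \<in> S" "s \<otimes> t = t \<otimes> s" shows "t \<otimes> s \<otimes> t = s"
  using assms by (metis letter_cancel(2) letter_closed)

lemma inversions_cong: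
  assumes "u \<in> lists S" "v \<in> lists S" "wprod u = wprod v"
  shows "inversions u = inversions v"
  unfolding inversions_def
proof (rule fold_word_invariant[where Q = "Pow (carrier W)"])
  fix s a assume "s \<in> S" "a \<in> Pow (carrier W)"
  then have "x \<in> flip_wall s (flip_wall s a) \<longleftrightarrow> x \<in> a" if "x \<in> carrier W" for x
    using that conj_cancel[of s x] conj_eq_iff[of s x s] by (auto simp: flip_wall_def)
  then show "flip_wall s (flip_wall s a) = a"
    using \<open>a \<in> Pow (carrier W)\<close> by (auto simp: flip_wall_def)
next
  fix s t a assume st: "s \<in> S" "t \<in> S" "s \<noteq> t" "s \<otimes> t = t \<otimes> s" and a: "a \<in> Pow (carrier W)"
  have "x \<in> flip_wall s (flip_wall t a) \<longleftrightarrow> x \<in> flip_wall t (flip_wall s a)"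
    if x: "x \<in> carrier W" for x
  proof -
    have *: "t \<otimes> (s \<otimes> x \<otimes> s) \<otimes> t = s \<otimes> (t \<otimes> x \<otimes> t) \<otimes> s"
    proof -
      have "t \<otimes> (s \<otimes> x \<otimes> s) \<otimes> t = (t \<otimes> s) \<otimes> x \<otimes> (s \<otimes> t)"
        using st(1,2) x by (simp add: m_assoc)
      also have "\<dots> = (s \<otimes> t) \<otimes> x \<otimes> (t \<otimes> s)" by (simp only: st(4))
      also have "\<dots> = s \<otimes> (t \<otimes> x \<otimes> t) \<otimes> s"
        using st(1,2) x by (simp add: m_assoc)
      finally show ?thesis by (simp only:)
    qed
    have "s \<otimes> t \<otimes> s = t" "t \<otimes> s \<otimes> t = s" using conj_commuting st by auto
    then have fix_iff: "s \<otimes> x \<otimes> s = t \<longleftrightarrow> x = t" "t \<otimes> x \<otimes> t = s \<longleftrightarrow> x = s"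
      using st(1,2) x conj_eq_iff[of s x t] conj_eq_iff[of t x s] by auto
    have "x \<in> flip_wall s (flip_wall t a) \<longleftrightarrow>
        ((t \<otimes> (s \<otimes> x \<otimes> s) \<otimes> t \<in> a) \<noteq> (s \<otimes> x \<otimes> s = t)) \<noteq> (x = s)"
      "x \<in> flip_wall t (flip_wall s a) \<longleftrightarrow>
        ((s \<otimes> (t \<otimes> x \<otimes> t) \<otimes> s \<in> a) \<noteq> (t \<otimes> x \<otimes> t = s)) \<noteq> (x = t)"
      using st(1,2) x by (simp_all add: flip_wall_def)
    then show ?thesis unfolding * fix_iff by blast
  qed
  moreover have "flip_wall y b \<subseteq> carrier W" for y b
    unfolding flip_wall_def by blast
  ultimately show "flip_wall s (flip_wall t a) = flip_wall t (flip_wall s a)"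
    by blast
qed (use assms in \<open>simp_all add: flip_wall_def Collect_mono\<close>)

text \<open>
  Multiplying \<open>s\<^sub>1 \<dots> s\<^sub>k\<close> by the \<open>i\<close>-th of its reflections deletes the letter \<open>s\<^sub>i\<close>.
\<close>

lemma inversion_deletion:
  assumes "u \<in> lists S" "x \<in> inversions u"
  shows "\<exists>u1 t u2. u = u1 @ t # u2 \<and> wprod u \<otimes> x = wprod (u1 @ u2)"
  using assms
proof (induction u arbitrary: x rule: rev_induct)
  case Nil
  then show ?case by simp
next
  case (snoc s u)
  then have s: "s \<in> S" "u \<in> lists S" by auto
  have x: "x \<in> carrier W" "(s \<otimes> x \<otimes> s \<in> inversions u) \<noteq> (x = s)"
    using snoc.prems by (auto simp: inversions_snoc flip_wall_def)
  show ?case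
  proof (cases "x = s")
    case True
    then show ?thesis using s by (intro exI[of _ u] exI[of _ s] exI[of _ "[]"]) simp
  next
    case False
    then have "s \<otimes> x \<otimes> s \<in> inversions u" using x by simp
    then obtain u1 t u2 where u: "u = u1 @ t # u2" "wprod u \<otimes> (s \<otimes> x \<otimes> s) = wprod (u1 @ u2)"
      using snoc.IH s by blast
    have l: "u1 \<in> lists S" "u2 \<in> lists S" "t \<in> S" using u s by auto
    have "wprod (u1 @ (u2 @ [s])) = wprod u \<otimes> (s \<otimes> x \<otimes> s) \<otimes> s"
      using u(2) l s by (simp add: m_assoc)
    also have "\<dots> = wprod (u @ [s]) \<otimes> x"
      using s x by (simp add: m_assoc)
    finally show ?thesis using u(1)
      by (intro exI[of _ u1] exI[of _ t] exI[of _ "u2 @ [s]"]) simp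
  qed
qed

lemma letter_in_inversions_snoc:
  "s \<in> S \<Longrightarrow> s \<in> inversions (u @ [s]) \<longleftrightarrow> s \<notin> inversions u"
  by (simp add: inversions_snoc flip_wall_def)

lemma descent_if_inversion:
  assumes "u \<in> lists S" "s \<in> S" "s \<in> inversions u" shows "descent (wprod u) s"
proof -
  obtain v where v: "reduced v" "wprod v = wprod u" using reduced_exists assms by blast
  then have "s \<in> inversions v" using inversions_cong assms reduced_letters by blast
  then obtain u1 t u2 where d: "v = u1 @ t # u2" "wprod v \<otimes> s = wprod (u1 @ u2)"
    using inversion_deletion v reduced_letters by blast
  have "len (wprod v \<otimes> s) \<le> length (u1 @ u2)"
    unfolding d(2) using reduced_letters[OF v(1)] d(1) by (intro len_le) auto
  also have "\<dots> < len (wprod v)" using reduced_length[OF v(1)] d(1) by simp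
  finally show ?thesis using v(2) assms by (simp add: descent_def)
qed

text \<open>
  An inversion shortens by the deletion of a letter. Conversely, appending \<open>s\<close> toggles whether \<open>s\<close>
  is an inversion; were \<open>s\<close> not one of \<open>w\<close>, it would be one of \<open>ws\<close>, and both \<open>ws\<close> and
  \<open>(ws)s = w\<close> would be shorter than their predecessors.
\<close>

lemma descent_iff_inversion:
  assumes u: "u \<in> lists S" and s: "s \<in> S"
  shows "descent (wprod u) s \<longleftrightarrow> s \<in> inversions u"
proof
  assume d: "descent (wprod u) s"
  show "s \<in> inversions u"
  proof (rule ccontr)
    assume "s \<notin> inversions u"
    then have "descent (wprod (u @ [s])) s"
      using u s by (intro descent_if_inversion) (auto simp: letter_in_inversions_snoc)
    with d show False using u s by (simp add: descent_def)
  qed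
qed (rule descent_if_inversion[OF u s])

lemma descent_letter: "descent w s \<Longrightarrow> s \<in> S"
  by (simp add: descent_def)

lemma descent_mult_letter:
  assumes "w \<in> carrier W" "s \<in> S" shows "descent (w \<otimes> s) s \<longleftrightarrow> \<not> descent w s"
proof -
  obtain u where u: "u \<in> lists S" "wprod u = w" using wprod_surj[OF assms(1)] .
  have "descent (wprod (u @ [s])) s \<longleftrightarrow> \<not> descent (wprod u) s"
    using u assms descent_iff_inversion[of "u @ [s]"] descent_iff_inversion[of u]
      letter_in_inversions_snoc by simp
  then show ?thesis using u assms by simp
qed

text \<open>
  Conjugation by \<open>t\<close> fixes \<open>s\<close>, so appending \<open>t\<close> does not affect whether \<open>s\<close> is an inversion. This
  is what makes the descent \<open>s\<close> constant along residues of letters commuting with \<open>s\<close>.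
\<close>

lemma descent_mult_commuting:
  assumes "w \<in> carrier W" "s \<in> S" "t \<in> S" "s \<noteq> t" "s \<otimes> t = t \<otimes> s"
  shows "descent (w \<otimes> t) s \<longleftrightarrow> descent w s"
proof -
  obtain u where u: "u \<in> lists S" "wprod u = w" using wprod_surj[OF assms(1)] .
  have "s \<in> inversions (u @ [t]) \<longleftrightarrow> s \<in> inversions u"
    using assms conj_commuting[OF assms(2,3,5)] by (simp add: inversions_snoc flip_wall_def)
  then have "descent (wprod (u @ [t])) s \<longleftrightarrow> descent (wprod u) s"
    using u assms descent_iff_inversion[of "u @ [t]"] descent_iff_inversion[of u] by simp
  then show ?thesis using u assms by simp
qed

lemma len_ascent:
  assumes "w \<in> carrier W" "s \<in> S" "\<not> descent w s" shows "len (w \<otimes> s) = Suc (len w)"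
proof -
  have "descent (w \<otimes> s) s" using descent_mult_letter assms by blast
  then have "len w < len (w \<otimes> s)" using assms by (simp add: descent_def)
  then show ?thesis using len_mult_le[of w "[s]"] assms by simp
qed

lemma len_descent:
  assumes "w \<in> carrier W" "descent w s" shows "Suc (len (w \<otimes> s)) = len w"
  using len_ascent[of "w \<otimes> s" s] descent_mult_letter[of w s] assms descent_letter[OF assms(2)]
  by simp

lemma not_descent_one: "\<not> descent \<one> s"
  by (simp add: descent_def len_one)

lemma reduced_snoc_iff:
  assumes "reduced u" "s \<in> S" shows "reduced (u @ [s]) \<longleftrightarrow> \<not> descent (wprod u) s"
proof
  assume "reduced (u @ [s])"
  then show "\<not> descent (wprod u) s"
    using assms reduced_length reduced_letters unfolding descent_def by fastforce
next
  assume "\<not> descent (wprod u) s"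
  then show "reduced (u @ [s])" using assms len_ascent reduced_letters reduced_length
    by (intro reducedI) auto
qed

lemma reduced_ending_in_descent:
  assumes "w \<in> carrier W" "descent w s"
  obtains u where "reduced (u @ [s])" "wprod (u @ [s]) = w" "wprod u = w \<otimes> s" "reduced u"
proof -
  have s: "s \<in> S" using assms descent_letter by blast
  obtain u where u: "reduced u" "wprod u = w \<otimes> s"
    using reduced_exists[of "w \<otimes> s"] assms s by auto
  then have "\<not> descent (wprod u) s" using descent_mult_letter assms s by simp
  then have "reduced (u @ [s])" using reduced_snoc_iff u s by blast
  moreover have "wprod (u @ [s]) = w" using u assms s reduced_letters by simp
  ultimately show ?thesis using that u by blast
qed

lemma descent_last:
  assumes "reduced (u @ [s])" shows "descent (wprod (u @ [s])) s"
  using assms reduced_prefix[OF assms] reduced_snoc_iff[of u s] reduced_letters[OF assms]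
    descent_mult_letter[of "wprod u" s] by simp

lemma descent_exists:
  assumes "w \<in> carrier W" "w \<noteq> \<one>" obtains s where "descent w s"
proof -
  obtain u where u: "reduced u" "wprod u = w" using reduced_exists assms by blast
  then have "u \<noteq> []" using assms by auto
  then show ?thesis using that u descent_last by (metis append_butlast_last_id)
qed

text \<open>
  The abelianisation: every relator contains each letter an even number of times. It identifies the
  letter that the exchange condition deletes.
\<close>

lemma letter_parity_cong:
  assumes "u \<in> lists S" "v \<in> lists S" "wprod u = wprod v"
  shows "even (count_list u a) \<longleftrightarrow> even (count_list v a)"
proof -
  define f where "f s b = (if s = a then \<not> b else b)" for s b
  have "fold f u b = (b = even (count_list u a))" for u b
    by (induction u arbitrary: b) (auto simp: f_def)
  moreover have "fold f u True = fold f v True"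
    by (rule fold_word_invariant[where Q = UNIV and f = f]) (use assms in \<open>auto simp: f_def\<close>)
  ultimately show ?thesis by simp
qed

text \<open>
  Sharper than the exchange condition of general Coxeter groups: the deleted letter is \<open>s\<close> itself,
  so that bringing a descent to the end of a reduced word only permutes its letters.
\<close>

lemma exchange:
  assumes u: "reduced u" and d: "descent (wprod u) s"
  shows "\<exists>u1 u2. u = u1 @ s # u2 \<and> reduced (u1 @ u2) \<and> wprod (u1 @ u2) = wprod u \<otimes> s"
proof -
  have s: "s \<in> S" and l: "u \<in> lists S" using d u descent_letter reduced_letters by auto
  have "s \<in> inversions u" using descent_iff_inversion[OF l s] d by simp
  from inversion_deletion[OF l this] obtain u1 t u2
    where e: "u = u1 @ t # u2" "wprod u \<otimes> s = wprod (u1 @ u2)" by blast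
  have l': "u1 @ u2 \<in> lists S" using l e by auto
  have "even (count_list (u @ [s]) t) \<longleftrightarrow> even (count_list (u1 @ u2) t)"
    using l l' s e(2) by (intro letter_parity_cong) simp_all
  then have "t = s" using e(1) by (auto split: if_splits)
  moreover have "reduced (u1 @ u2)"
    using len_descent[OF _ d] l l' reduced_length[OF u] e by (intro reducedI) auto
  ultimately show ?thesis using e by auto
qed

section \<open>Two descents commute\<close>

text \<open>
  Forgetting all letters other than \<open>s\<close> and \<open>t\<close> and cancelling adjacent equal ones maps the group to
  the infinite dihedral group, in which a word without adjacent equal letters is as short as possible. Words are
  built in reverse order, hence the \<^const>\<open>hd\<close>.
\<close>

lemma dihedral_reduction:
  assumes st: "s \<in> S" "t \<in> S" "s \<otimes> t \<noteq> t \<otimes> s"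
    and p: "p \<in> lists {s, t}" "distinct_adj p" and q: "q \<in> lists {s, t}" "wprod p = wprod q"
  shows "length p \<le> length q"
proof -
  define f where "f x a = (if x \<notin> {s, t} then a :: 'w list
    else if a \<noteq> [] \<and> hd a = x then tl a else x # a)"
    for x a
  have *: "fold f q a = rev q @ a" if "distinct_adj (rev q @ a)" "q \<in> lists {s, t}" for q a :: "'w list"
    using that
  proof (induction q arbitrary: a)
    case (Cons x q)
    then have "f x a = x # a"
      by (cases a) (auto simp: f_def distinct_adj_append_iff)
    then show ?case using Cons by simp
  qed simp
  have le: "length (fold f q a) \<le> length q + length a" for q a :: "'w list"
  proof (induction q arbitrary: a)
    case (Cons x q)
    have "length (f x a) \<le> Suc (length a)" by (auto simp: f_def)
    then show ?case using Cons[of "f x a"] by simp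
  qed simp
  have "fold f p [] = fold f q []"
  proof (rule fold_word_invariant[where Q = "{a. distinct_adj a}"])
    fix x a assume "x \<in> S" and a: "a \<in> {a :: 'w list. distinct_adj a}"
    then show "f x a \<in> {a. distinct_adj a}" "f x (f x a) = a"
      by (cases a; cases "tl a"; auto simp: f_def)+
  next
    fix x y and a :: "'w list" assume "x \<in> S" "y \<in> S" "x \<noteq> y" "x \<otimes> y = y \<otimes> x"
    then have "x \<notin> {s, t} \<or> y \<notin> {s, t}" using st by auto
    then show "f x (f y a) = f y (f x a)" by (auto simp: f_def)
  qed (use st p q in auto)
  then show ?thesis using *[of p "[]"] p le[of q "[]"] by simp
qed

text \<open>
  Words \<open>\<dots>tsts\<close> ending in the first of the two letters.
\<close>

fun alternating :: "nat \<Rightarrow> 'w \<Rightarrow> 'w \<Rightarrow> 'w list" where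
  "alternating 0 s t = []"
| "alternating (Suc k) s t = alternating k t s @ [s]"

lemma length_alternating [simp]: "length (alternating k s t) = k"
  by (induction k arbitrary: s t) auto

lemma alternating_letters: "alternating k s t \<in> lists {s, t}"
  by (induction k arbitrary: s t) fastforce+

lemma distinct_adj_alternating: "s \<noteq> t \<Longrightarrow> distinct_adj (alternating k s t)"
proof (induction k arbitrary: s t)
  case (Suc k)
  then show ?case by (cases k) (auto simp: distinct_adj_append_iff)
qed auto

text \<open>
  If \<open>s\<close> and \<open>t\<close> do not commute, an element with both descents has reduced words ending in arbitrarily
  long alternating words. Indeed, let a reduced word end in an alternating word \<open>p\<close> whose last letter
  is \<open>s\<close>, and move the descent \<open>t\<close> to the end by the exchange condition: the deleted letter cannot
  lie in \<open>p\<close>, as \<open>pt\<close> is reduced in the infinite dihedral group, so the longer alternating word \<open>pt\<close> is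
  now a suffix.
\<close>

lemma descents_commute:
  assumes w: "w \<in> carrier W" and ds: "descent w s" and dt: "descent w t"
  shows "s \<otimes> t = t \<otimes> s"
proof (rule ccontr)
  assume nc: "s \<otimes> t \<noteq> t \<otimes> s"
  have step: "\<exists>b. reduced (b @ alternating (Suc k) y x) \<and> wprod (b @ alternating (Suc k) y x) = w"
    if a: "reduced (a @ alternating k x y)" "wprod (a @ alternating k x y) = w"
      and dy: "descent w y" and xy: "{x, y} \<subseteq> S" "x \<otimes> y \<noteq> y \<otimes> x" for a k x y
  proof -
    let ?p = "alternating k x y"
    obtain u1 u2 where e: "a @ ?p = u1 @ y # u2" "reduced (u1 @ u2)" "wprod (u1 @ u2) = w \<otimes> y"
      using exchange[OF a(1), unfolded a(2), OF dy] by blast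
    have pl: "?p \<in> lists {x, y}" by (rule alternating_letters)
    have l: "a \<in> lists S" "?p \<in> lists S" "y \<in> S" using reduced_letters[OF a(1)] xy by auto
    from e(1) consider c where "a = u1 @ y # c" "c @ ?p = u2"
      | c where "u1 = a @ c" "?p = c @ y # u2"
      by (auto simp: append_eq_append_conv2 append_eq_Cons_conv)
    then show ?thesis
    proof cases
      case 1
      have "u1 @ u2 \<in> lists S" using 1 l by auto
      then have "wprod ((u1 @ u2) @ [y]) = wprod (u1 @ u2) \<otimes> y"
        using l by (subst wprod_append) auto
      then have "wprod ((u1 @ c) @ alternating (Suc k) y x) = wprod (u1 @ u2) \<otimes> y"
        by (simp only: 1(2)[symmetric] alternating.simps append_assoc)
      also have "\<dots> = w" using e(3) w l by simp
      finally have "wprod ((u1 @ c) @ alternating (Suc k) y x) = w" .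
      moreover have "reduced ((u1 @ c) @ alternating (Suc k) y x)"
        using 1 l calculation reduced_length[OF a(1)] a(2)
        by (intro reducedI) auto
      ultimately show ?thesis by blast
    next
      case 2
      \<comment> \<open>Cancelling \<open>a\<close> would represent the longer alternating word by the shorter \<open>c @ u2\<close>.\<close>
      have cl: "c \<in> lists {x, y}" "u2 \<in> lists {x, y}" using pl 2 by auto
      then have cS: "c \<in> lists S" "u2 \<in> lists S" using xy by auto
      have "wprod a \<otimes> wprod (alternating (Suc k) y x) = w \<otimes> y"
        using a(2) l by (auto simp: m_assoc)
      also have "\<dots> = wprod a \<otimes> wprod (c @ u2)" using e(3) 2 cS l by (simp add: m_assoc)
      finally have "wprod (alternating (Suc k) y x) = wprod (c @ u2)"
        using l cS by (simp add: l_cancel)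
      then have "length (alternating (Suc k) y x) \<le> length (c @ u2)"
        using alternating_letters[of "Suc k" y x] cl xy
        by (intro dihedral_reduction[where s = y and t = x] distinct_adj_alternating)
           (auto simp: insert_commute)
      moreover have "length ?p = Suc (length (c @ u2))" using 2(2) by simp
      ultimately show ?thesis by simp
    qed
  qed
  have S: "s \<in> S" "t \<in> S" using ds dt descent_letter by auto
  have "(\<exists>a. reduced (a @ alternating k s t) \<and> wprod (a @ alternating k s t) = w) \<and>
        (\<exists>b. reduced (b @ alternating k t s) \<and> wprod (b @ alternating k t s) = w)" for k
  proof (induction k)
    case 0
    obtain u where "reduced u" "wprod u = w" using reduced_exists[OF w] .
    then show ?case by (simp, blast)
  next
    case (Suc k)
    then obtain a b where a: "reduced (a @ alternating k s t)" "wprod (a @ alternating k s t) = w"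
      and b: "reduced (b @ alternating k t s)" "wprod (b @ alternating k t s) = w" by blast
    show ?case using step[OF a dt] step[OF b ds] S nc by (metis bot.extremum insert_subset)
  qed
  then obtain a where "reduced (a @ alternating (Suc (len w)) s t)"
    "wprod (a @ alternating (Suc (len w)) s t) = w" by blast
  then show False using reduced_length[of "a @ alternating (Suc (len w)) s t"] by simp
qed

section \<open>Minimal elements of parabolic cosets\<close>

text \<open>
  Letters can be deleted from \<open>uv\<close> until it is reduced, and this keeps the second part a word over
  \<open>J\<close>. Only the length of the first part is recorded.
\<close>

lemma deletion:
  assumes "u \<in> lists S" "J \<subseteq> S" "v \<in> lists J"
  shows "\<exists>u' v'. reduced (u' @ v') \<and> wprod (u' @ v') = wprod (u @ v) \<and>
           length u' \<le> length u \<and> v' \<in> lists J"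
  using assms(3)
proof (induction v rule: rev_induct)
  case Nil
  obtain u' where "reduced u'" "wprod u' = wprod u" using reduced_exists assms by blast
  then show ?case using len_le[OF assms(1)] reduced_length[of u']
    by (intro exI[of _ u'] exI[of _ "[]"]) auto
next
  case (snoc s v)
  then obtain u' v' where IH: "reduced (u' @ v')" "wprod (u' @ v') = wprod (u @ v)"
    "length u' \<le> length u" "v' \<in> lists J" by auto
  have s: "s \<in> S" "s \<in> J" "v \<in> lists S" using snoc.prems assms by auto
  have prod: "wprod (u @ v @ [s]) = wprod (u' @ v') \<otimes> s"
    using IH(2) s assms(1) by (simp add: m_assoc)
  show ?case
  proof (cases "descent (wprod (u' @ v')) s")
    case False
    then have r: "reduced (u' @ v' @ [s])" using reduced_snoc_iff[OF IH(1) s(1)] by simp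
    have "u' \<in> lists S" "v' \<in> lists S" using IH(1) reduced_letters by force+
    then have "wprod (u' @ v' @ [s]) = wprod (u @ v @ [s])"
      unfolding prod using s by (simp add: m_assoc)
    with r show ?thesis
      using IH s by (intro exI[of _ u'] exI[of _ "v' @ [s]"]) auto
  next
    case True
    then obtain u1 u2 where e: "u' @ v' = u1 @ s # u2" "reduced (u1 @ u2)"
      "wprod (u1 @ u2) = wprod (u' @ v') \<otimes> s" using exchange[OF IH(1)] by blast
    from e(1) consider c where "u' = u1 @ s # c" "c @ v' = u2"
      | c where "u1 = u' @ c" "v' = c @ s # u2"
      by (auto simp: append_eq_append_conv2 append_eq_Cons_conv)
    then show ?thesis
    proof cases
      case 1
      then show ?thesis using e IH prod by (intro exI[of _ "u1 @ c"] exI[of _ v']) auto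
    next
      case 2
      then show ?thesis using e IH prod by (intro exI[of _ u'] exI[of _ "c @ u2"]) auto
    qed
  qed
qed

text \<open>
  Write \<open>w = y v\<^sup>-\<^sup>1\<close> with \<open>y = wv\<close>, and reduce the right-hand side by deletions. Nothing of \<open>v\<^sup>-\<^sup>1\<close> can
  survive, because its last letter would be a descent of \<open>w\<close> in \<open>J\<close>; so \<open>w\<close> is represented by a word
  no longer than \<open>y\<close>.
\<close>

lemma len_minimal_in_coset:
  assumes w: "w \<in> carrier W" and J: "J \<subseteq> S" and nd: "\<And>s. s \<in> J \<Longrightarrow> \<not> descent w s"
    and v: "v \<in> lists J"
  shows "len w \<le> len (w \<otimes> wprod v)"
proof -
  have vS: "v \<in> lists S" using v J by auto
  have "wprod v \<otimes> wprod (rev v) = \<one>"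
    using vS
  proof (induction v)
    case (Cons s v)
    then have "s \<in> S" "v \<in> lists S" "rev v \<in> lists S" by auto
    then have "wprod (s # v) \<otimes> wprod (rev (s # v)) = s \<otimes> (wprod v \<otimes> wprod (rev v)) \<otimes> s"
      by (simp add: m_assoc)
    then show ?case using Cons by simp
  qed simp
  then have inv: "w \<otimes> wprod v \<otimes> wprod (rev v) = w"
    using w vS by (simp add: m_assoc[of w "wprod v" "wprod (rev v)"])
  obtain u where u: "reduced u" "wprod u = w \<otimes> wprod v"
    using reduced_exists[of "w \<otimes> wprod v"] w vS by auto
  obtain u' v' where d: "reduced (u' @ v')" "wprod (u' @ v') = wprod (u @ rev v)"
    "length u' \<le> length u" "v' \<in> lists J"
    using deletion[OF reduced_letters[OF u(1)] J, of "rev v"] v by auto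
  have prod: "wprod (u' @ v') = w" using d(2) u inv vS reduced_letters by simp
  have "v' = []"
  proof (rule ccontr)
    assume ne: "v' \<noteq> []"
    then have eq: "(u' @ butlast v') @ [last v'] = u' @ v'" by simp
    then have "descent w (last v')"
      using descent_last[of "u' @ butlast v'" "last v'"] d(1) prod by simp
    moreover have "last v' \<in> J" using ne d(4) last_in_set by auto
    ultimately show False using nd by blast
  qed
  then have "len w = length u'" using reduced_length[OF d(1)] prod by simp
  also have "\<dots> \<le> len (w \<otimes> wprod v)" using d(3) reduced_length[OF u(1)] u(2) by simp
  finally show ?thesis .
qed

section \<open>Firm elements\<close>

lemma firm_iff:
  assumes "w \<in> carrier W" shows "firm W S w \<longleftrightarrow> (\<exists>!r. descent w r)"
proof
  assume "firm W S w"
  then obtain r where r: "r \<in> S" "\<And>u. reduced u \<Longrightarrow> wprod u = w \<Longrightarrow> u \<noteq> [] \<and> last u = r"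
    unfolding firm_def by blast
  have "w \<noteq> \<one>" using r(2)[OF reduced_Nil] by auto
  then obtain s where s: "descent w s" using descent_exists assms by blast
  have "s = r" if "descent w s" for s
    using reduced_ending_in_descent[OF assms that] r(2) by (metis last_snoc)
  with s show "\<exists>!r. descent w r" by blast
next
  assume "\<exists>!r. descent w r"
  then obtain r where r: "descent w r" "\<And>s. descent w s \<Longrightarrow> s = r" by blast
  have "u \<noteq> [] \<and> last u = r" if u: "reduced u" "wprod u = w" for u
  proof -
    have "u \<noteq> []" using u r(1) not_descent_one by auto
    then show ?thesis using u r(2) descent_last by (metis append_butlast_last_id)
  qed
  then show "firm W S w" unfolding firm_def using r(1) descent_letter by blast
qed

text \<open>
  If \<open>p\<close> is not firm, a descent other than its last letter \<open>s\<close> can be moved to the end by the exchange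
  condition and then cut off. Neither step removes an occurrence of \<open>s\<close>, so this ends with a firm
  prefix that still contains more than \<open>n\<close> letters.
\<close>

lemma firm_prefix_if_repeated_letter:
  assumes "reduced p" "p \<noteq> []" "n < count_list p (last p)"
  shows "\<exists>u1 u2. reduced (u1 @ u2) \<and> wprod (u1 @ u2) = wprod p \<and> n < length u1 \<and>
           firm W S (wprod u1)"
  using assms
proof (induction "length p" arbitrary: p rule: less_induct)
  case less
  let ?s = "last p"
  have pS: "p \<in> lists S" using less.prems reduced_letters by blast
  have ds: "descent (wprod p) ?s" using descent_last less.prems by (metis append_butlast_last_id)
  show ?case
  proof (cases "firm W S (wprod p)")
    case True
    have "n < length p" using less.prems(3) count_le_length[of p ?s] by linarith
    then show ?thesis using True less.prems by (intro exI[of _ p] exI[of _ "[]"]) auto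
  next
    case False
    then obtain t where t: "descent (wprod p) t" "t \<noteq> ?s"
      using firm_iff[of "wprod p"] ds pS by auto
    obtain u1 u2 where e: "p = u1 @ t # u2" "reduced (u1 @ u2)" "wprod (u1 @ u2) = wprod p \<otimes> t"
      using exchange[OF less.prems(1) t(1)] by blast
    have tS: "t \<in> S" using t descent_letter by blast
    have ne: "u2 \<noteq> []" using e(1) t(2) by auto
    then have "last (u1 @ u2) = ?s" using e(1) by simp
    moreover from this have "n < count_list (u1 @ u2) (last (u1 @ u2))"
      using less.prems(3) e(1) t(2) by simp
    ultimately obtain v1 v2 where v: "reduced (v1 @ v2)" "wprod (v1 @ v2) = wprod p \<otimes> t"
      "n < length v1" "firm W S (wprod v1)"
      using less.hyps[of "u1 @ u2"] e ne by auto
    have "wprod (v1 @ v2 @ [t]) = wprod p"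
      using v(2) reduced_letters[OF v(1)] tS pS by (auto simp: m_assoc[symmetric])
    moreover from this have "reduced (v1 @ v2 @ [t])"
      using reduced_letters[OF v(1)] tS reduced_length[OF v(1)] v(2) len_descent[OF _ t(1)] pS
      by (intro reducedI) auto
    ultimately show ?thesis using v by (intro exI[of _ v1] exI[of _ "v2 @ [t]"]) auto
  qed
qed

text \<open>
  By the pigeonhole principle a word longer than \<open>n |S|\<close> contains some letter more than \<open>n\<close> times;
  the previous lemma applies to its prefix up to the last occurrence of this letter.
\<close>

lemma long_has_firm_prefix:
  assumes w: "w \<in> carrier W" and long: "n * card S < len w"
  shows "\<exists>u1 u2. reduced (u1 @ u2) \<and> wprod (u1 @ u2) = w \<and> n < length u1 \<and> firm W S (wprod u1)"
proof -
  obtain u where u: "reduced u" "wprod u = w" using reduced_exists[OF w] .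
  have uS: "u \<in> lists S" using u reduced_letters by blast
  have "\<exists>s\<in>S. n < count_list u s"
  proof (rule ccontr)
    assume "\<not> (\<exists>s\<in>S. n < count_list u s)"
    then have "(\<Sum>s\<in>S. count_list u s) \<le> (\<Sum>s\<in>S. n)" by (intro sum_mono) auto
    moreover have "length u = (\<Sum>s\<in>S. count_list u s)"
      using uS finite_S sum_count_set[OF _ finite_S, of u] by (auto simp: subset_iff)
    ultimately show False using long reduced_length[OF u(1)] u(2) by (simp add: mult.commute)
  qed
  then obtain s where s: "s \<in> S" "n < count_list u s" by blast
  then have "s \<in> set u" using count_list_0_iff[of u s] by (metis not_less_zero)
  then obtain p q where pq: "u = (p @ [s]) @ q" "s \<notin> set q"
    using split_list_last[of s u] by auto
  have "count_list u s = count_list (p @ [s]) s" using pq count_list_0_iff[of q s] by simp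
  then have "n < count_list (p @ [s]) (last (p @ [s]))" using s by simp
  then obtain u1 u2 where v: "reduced (u1 @ u2)" "wprod (u1 @ u2) = wprod (p @ [s])"
    "n < length u1" "firm W S (wprod u1)"
    using firm_prefix_if_repeated_letter[of "p @ [s]" n] u(1) pq(1) reduced_prefix
    by blast
  have q: "q \<in> lists S" "p @ [s] \<in> lists S" using uS pq by auto
  have v': "u1 @ u2 \<in> lists S" using v reduced_letters by blast
  have "wprod ((u1 @ u2) @ q) = wprod (p @ [s]) \<otimes> wprod q"
    using wprod_append[OF v' q(1)] v(2) by simp
  also have "\<dots> = w" using wprod_append[OF q(2,1)] pq(1) u(2) by simp
  finally have prod: "wprod (u1 @ u2 @ q) = w" by simp
  have "length (u1 @ u2) = length (p @ [s])"
    using reduced_length[OF v(1)] v(2) reduced_length reduced_prefix u(1) pq(1) by metis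
  then have "reduced (u1 @ u2 @ q)"
    using prod reduced_length[OF u(1)] u(2) pq(1) v' q
    by (intro reducedI) auto
  then show ?thesis using prod v by blast
qed

end

section \<open>Panels, galleries and the Weyl distance\<close>

locale ra_building = ra_coxeter W S
  for W :: "('w, 'x) monoid_scheme" (structure) and S :: "'w set" +
  fixes \<Delta> :: "('c, 'w) coloured_graph" and \<delta> :: "'c \<Rightarrow> 'c \<Rightarrow> 'w"
  assumes building: "right_angled_building W S \<Delta> \<delta>"
begin

abbreviation Ch :: "'c set" where "Ch \<equiv> chambers \<Delta>"
abbreviation adj :: "'w \<Rightarrow> 'c \<Rightarrow> 'c \<Rightarrow> bool" where "adj \<equiv> adjacent \<Delta>"

definition panel :: "'w \<Rightarrow> 'c \<Rightarrow> 'c set" where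
  "panel s c = {d. (adj s)\<^sup>*\<^sup>* c d}"

lemma system: "chamber_system S \<Delta>"
  and delta_closed [simp, intro]: "c \<in> Ch \<Longrightarrow> d \<in> Ch \<Longrightarrow> \<delta> c d \<in> carrier W"
  and delta_gallery: "reduced u \<Longrightarrow> c \<in> Ch \<Longrightarrow> d \<in> Ch \<Longrightarrow>
    \<delta> c d = wprod u \<longleftrightarrow> (\<exists>cs. gallery_of_type \<Delta> u c d cs)"
  using building unfolding right_angled_building_def by auto

lemma adj_chambers:
  assumes "adj s c d" shows "c \<in> Ch" "d \<in> Ch" "c \<noteq> d" "s \<in> S"
proof -
  have "{c, d} \<subseteq> Ch" "card {c, d} = 2" "s \<in> S"
    using assms system unfolding adjacent_def chamber_system_def by auto
  then show "c \<in> Ch" "d \<in> Ch" "c \<noteq> d" "s \<in> S" by auto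
qed

lemma adj_sym: "adj s c d \<Longrightarrow> adj s d c"
  by (simp add: adjacent_def insert_commute)

lemma adj_letter_unique: "adj s c d \<Longrightarrow> adj t c d \<Longrightarrow> s = t"
  by (simp add: adjacent_def)

lemma panel_in_panels: "c \<in> Ch \<Longrightarrow> panel s c \<in> panels \<Delta> s"
  by (auto simp: panels_def panel_def)

lemma panel_complete:
  assumes "c \<in> Ch" "s \<in> S" "d \<in> panel s c" "e \<in> panel s c" "d \<noteq> e" shows "adj s d e"
  using assms panel_in_panels[of c s] system unfolding chamber_system_def by blast

lemma adj_trans:
  assumes "adj s c d" "adj s d e" "c \<noteq> e" shows "adj s c e"
proof -
  have "c \<in> panel s c" "e \<in> panel s c"
    using assms(1,2) by (auto simp: panel_def)
  then show ?thesis using panel_complete adj_chambers[OF assms(1)] assms(3) by blast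
qed

lemma mem_panel_iff:
  assumes "c \<in> Ch" "s \<in> S" shows "d \<in> panel s c \<longleftrightarrow> d = c \<or> adj s c d"
  using panel_complete[OF assms, of c d] by (auto simp: panel_def)

lemma panel_refl: "c \<in> panel s c"
  by (simp add: panel_def)

lemma panel_subset: "c \<in> Ch \<Longrightarrow> s \<in> S \<Longrightarrow> panel s c \<subseteq> Ch"
  using mem_panel_iff[of c s] adj_chambers(2)[of s c] by auto

lemma panel_cong:
  assumes "c \<in> Ch" "s \<in> S" "d \<in> panel s c" shows "panel s d = panel s c"
proof -
  have d: "d \<in> Ch" using panel_subset[OF assms(1,2)] assms(3) by blast
  have "d = c \<or> adj s c d" using mem_panel_iff[OF assms(1,2)] assms(3) by simp
  then have "y = d \<or> adj s d y \<longleftrightarrow> y = c \<or> adj s c y" for y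
    using adj_sym adj_trans by metis
  then show ?thesis
    using mem_panel_iff[OF assms(1,2)] mem_panel_iff[OF d assms(2)] by blast
qed

text \<open>
  Galleries of a given type without the list of their chambers, which allows induction on the type.
\<close>

fun path :: "'w list \<Rightarrow> 'c \<Rightarrow> 'c \<Rightarrow> bool" where
  "path [] c d \<longleftrightarrow> c = d \<and> c \<in> Ch"
| "path (s # u) c d \<longleftrightarrow> (\<exists>e. adj s c e \<and> path u e d)"

lemma path_chambers: "path u c d \<Longrightarrow> c \<in> Ch \<and> d \<in> Ch \<and> u \<in> lists S"
proof (induction u arbitrary: c)
  case (Cons s u)
  then obtain e where "adj s c e" "path u e d" by auto
  then show ?case using Cons.IH[of e] adj_chambers[of s c e] by simp
qed simp

lemma path_append: "path (u @ v) c d \<longleftrightarrow> (\<exists>e. path u c e \<and> path v e d)"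
  by (induction u arbitrary: c) (auto dest: path_chambers)

lemma path_snoc: "path (u @ [s]) c d \<longleftrightarrow> (\<exists>e. path u c e \<and> adj s e d)"
  by (auto simp: path_append dest: adj_chambers)

lemma path_rev: "path u c d \<Longrightarrow> path (rev u) d c"
  by (induction u arbitrary: c) (auto simp: path_snoc dest: adj_sym)

lemma gallery_take:
  assumes g: "gallery_of_type \<Delta> u c d cs" and "i \<le> length u"
  shows "path (take i u) c (cs ! i)"
  using assms(2)
proof (induction i)
  case 0
  then show ?case using g by (cases cs) (auto simp: gallery_of_type_def)
next
  case (Suc i)
  then have "adj (u ! i) (cs ! i) (cs ! Suc i)" using g by (simp add: gallery_of_type_def)
  then show ?case using Suc by (auto simp: take_Suc_conv_app_nth path_snoc)
qed

lemma gallery_drop: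
  assumes g: "gallery_of_type \<Delta> u c d cs" and "i \<le> length u"
  shows "path (drop i u) (cs ! i) d"
  using assms(2)
proof (induction i rule: inc_induct)
  case base
  have "cs \<noteq> []" "length cs = Suc (length u)" "last cs = d" "set cs \<subseteq> Ch"
    using g by (auto simp: gallery_of_type_def)
  then show ?case using last_in_set[of cs] by (auto simp: last_conv_nth)
next
  case (step i)
  then have "adj (u ! i) (cs ! i) (cs ! Suc i)" using g by (simp add: gallery_of_type_def)
  then show ?case using step by (auto simp: Cons_nth_drop_Suc[symmetric])
qed

lemma gallery_Cons:
  assumes a: "adj s c e" and cs: "gallery_of_type \<Delta> u e d cs"
  shows "gallery_of_type \<Delta> (s # u) c d (c # cs)"
proof -
  have ne: "cs \<noteq> []" "cs ! 0 = e" using cs by (cases cs; auto simp: gallery_of_type_def)+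
  have "adj ((s # u) ! i) ((c # cs) ! i) ((c # cs) ! Suc i)" if "i < length (s # u)" for i
    using that a cs ne by (cases i) (auto simp: gallery_of_type_def)
  then show ?thesis
    using cs ne adj_chambers[OF a] by (auto simp: gallery_of_type_def)
qed

lemma gallery_through:
  assumes "path u c e" "path v e d"
  shows "\<exists>cs. gallery_of_type \<Delta> (u @ v) c d cs \<and> cs ! length u = e"
  using assms(1)
proof (induction u arbitrary: c)
  case Nil
  have "\<exists>cs. gallery_of_type \<Delta> v e d cs \<and> cs ! 0 = e"
    using assms(2)
  proof (induction v arbitrary: e)
    case Nil
    then show ?case by (intro exI[of _ "[e]"]) (auto simp: gallery_of_type_def)
  next
    case (Cons s v)
    then obtain x cs where "adj s e x" "gallery_of_type \<Delta> v x d cs" by auto blast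
    then show ?case using gallery_Cons by (intro exI[of _ "e # cs"]) simp
  qed
  then show ?case using Nil by simp
next
  case (Cons s u)
  then obtain x where x: "adj s c x" "path u x e" by auto
  then obtain cs where "gallery_of_type \<Delta> (u @ v) x d cs" "cs ! length u = e"
    using Cons.IH by blast
  then show ?case using gallery_Cons[OF x(1)] by (intro exI[of _ "c # cs"]) simp
qed

lemma gallery_iff_path: "(\<exists>cs. gallery_of_type \<Delta> u c d cs) \<longleftrightarrow> path u c d"
proof
  assume "\<exists>cs. gallery_of_type \<Delta> u c d cs"
  then obtain cs where cs: "gallery_of_type \<Delta> u c d cs" ..
  then have "cs \<noteq> []" "length cs = Suc (length u)" "last cs = d"
    by (auto simp: gallery_of_type_def)
  then have "cs ! length u = d" by (simp add: last_conv_nth)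
  then show "path u c d" using gallery_take[OF cs, of "length u"] by simp
next
  assume "path u c d"
  then show "\<exists>cs. gallery_of_type \<Delta> u c d cs"
    using gallery_through[of "[]" c c u d] path_chambers[of u c d] by auto
qed

lemma delta_iff_path:
  "reduced u \<Longrightarrow> c \<in> Ch \<Longrightarrow> d \<in> Ch \<Longrightarrow> \<delta> c d = wprod u \<longleftrightarrow> path u c d"
  using delta_gallery gallery_iff_path by simp

lemma delta_path: "reduced u \<Longrightarrow> path u c d \<Longrightarrow> \<delta> c d = wprod u"
  using delta_iff_path path_chambers by blast

lemma delta_self: "c \<in> Ch \<Longrightarrow> \<delta> c c = \<one>"
  using delta_path[OF reduced_Nil, of c c] by simp

lemma delta_one: "c \<in> Ch \<Longrightarrow> d \<in> Ch \<Longrightarrow> \<delta> c d = \<one> \<Longrightarrow> c = d"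
  using delta_iff_path[OF reduced_Nil, of c d] by simp

lemma reduced_path_exists:
  assumes "c \<in> Ch" "d \<in> Ch"
  obtains u where "reduced u" "wprod u = \<delta> c d" "path u c d"
  using reduced_exists[OF delta_closed[OF assms]] delta_iff_path assms by metis

lemma delta_ascent:
  assumes b: "b \<in> Ch" and a: "adj s c d" and nd: "\<not> descent (\<delta> b c) s"
  shows "\<delta> b d = \<delta> b c \<otimes> s"
proof -
  note ch = adj_chambers[OF a]
  obtain u where u: "reduced u" "wprod u = \<delta> b c" "path u b c"
    using reduced_path_exists b ch(1) by blast
  then have "reduced (u @ [s])" using reduced_snoc_iff ch(4) nd by simp
  moreover have "path (u @ [s]) b d" using u a path_snoc by blast
  ultimately have "\<delta> b d = wprod (u @ [s])" by (rule delta_path)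
  then show ?thesis using u ch(4) reduced_letters[OF u(1)] by simp
qed

lemma descent_after_ascent:
  assumes "b \<in> Ch" "adj s c d" "\<not> descent (\<delta> b c) s" shows "descent (\<delta> b d) s"
  using delta_ascent[OF assms] assms adj_chambers[OF assms(2)] descent_mult_letter[of "\<delta> b c" s]
  by simp

text \<open>
  Every panel has a unique chamber closest to \<open>b\<close>, its gate: among the chambers \<open>c\<close> of an \<open>s\<close>-panel
  it is the one for which \<open>s\<close> is not a descent of \<open>\<delta> b c\<close>.
\<close>

lemma gate_exists:
  assumes b: "b \<in> Ch" and c: "c \<in> Ch" and d: "descent (\<delta> b c) s"
  obtains e where "adj s e c" "\<delta> b e = \<delta> b c \<otimes> s" "\<not> descent (\<delta> b e) s"
proof -
  obtain u where u: "reduced (u @ [s])" "wprod (u @ [s]) = \<delta> b c" "wprod u = \<delta> b c \<otimes> s" "reduced u"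
    using reduced_ending_in_descent[OF delta_closed[OF b c] d] by blast
  then have "path (u @ [s]) b c" using delta_iff_path b c by metis
  then obtain e where e: "path u b e" "adj s e c" using path_snoc by blast
  then have "\<delta> b e = \<delta> b c \<otimes> s" using delta_path u by simp
  moreover from this have "\<not> descent (\<delta> b e) s"
    using descent_mult_letter[of "\<delta> b c" s] d b c descent_letter[OF d] by simp
  ultimately show ?thesis using that e by blast
qed

lemma delta_adj_descents:
  assumes b: "b \<in> Ch" and a: "adj s c d" and dc: "descent (\<delta> b c) s" and dd: "descent (\<delta> b d) s"
  shows "\<delta> b c = \<delta> b d"
proof -
  note ch = adj_chambers[OF a]
  obtain e where e: "adj s e c" "\<delta> b e = \<delta> b c \<otimes> s" "\<not> descent (\<delta> b e) s"
    using gate_exists b ch(1) dc by blast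
  then have "adj s e d" using adj_trans a dd by blast
  then have "\<delta> b d = \<delta> b e \<otimes> s" using delta_ascent b e by blast
  then show ?thesis using e(2) b ch by simp
qed

lemma delta_adj:
  assumes b: "b \<in> Ch" and a: "adj s c d"
  shows "\<delta> b d = \<delta> b c \<or> \<delta> b d = \<delta> b c \<otimes> s"
proof (cases "descent (\<delta> b c) s \<and> \<not> descent (\<delta> b d) s")
  case True
  then have "\<delta> b c = \<delta> b d \<otimes> s" using delta_ascent b a adj_sym by blast
  then show ?thesis using b adj_chambers[OF a] by simp
next
  case False
  then show ?thesis using delta_ascent[OF b a] delta_adj_descents[OF b a] by metis
qed

lemma len_delta_path:
  "path u c d \<Longrightarrow> b \<in> Ch \<Longrightarrow> len (\<delta> b d) \<le> len (\<delta> b c) + length u"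
proof (induction u arbitrary: c)
  case (Cons s u)
  then obtain e where e: "adj s c e" "path u e d" by auto
  note ch = adj_chambers[OF e(1)]
  have "len (\<delta> b e) \<le> Suc (len (\<delta> b c))"
    using delta_adj[OF Cons.prems(2) e(1)] len_mult_le[of "\<delta> b c" "[s]"] ch Cons.prems(2) by auto
  then show ?case using Cons.IH[OF e(2) Cons.prems(2)] by simp
qed simp

lemma len_delta_le: "path u c d \<Longrightarrow> len (\<delta> c d) \<le> length u"
  using len_delta_path[of u c d c] path_chambers[of u c d] by (simp add: delta_self len_one)

lemma descent_adj_commuting:
  assumes b: "b \<in> Ch" and a: "adj t c d" and s: "s \<in> S" "s \<noteq> t" "s \<otimes> t = t \<otimes> s"
  shows "descent (\<delta> b c) s \<longleftrightarrow> descent (\<delta> b d) s"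
  using delta_adj[OF b a] descent_mult_commuting[of "\<delta> b c" s t] adj_chambers[OF a] b s by auto

text \<open>
  The words \<open>st\<close> and \<open>ts\<close> are both reduced and represent the same element.
\<close>

lemma square:
  assumes "adj s c d" "adj t d e" "s \<noteq> t" "s \<otimes> t = t \<otimes> s"
  obtains d' where "adj t c d'" "adj s d' e"
proof -
  note cd = adj_chambers[OF assms(1)] and de = adj_chambers[OF assms(2)]
  have red: "reduced [x, y]" if "x \<in> S" "y \<in> S" "x \<noteq> y" "x \<otimes> y = y \<otimes> x" for x y
  proof -
    have "reduced [x]" using reduced_snoc_iff[OF reduced_Nil that(1)] not_descent_one by simp
    then show ?thesis
      using reduced_snoc_iff[of "[x]" y] descent_mult_commuting[of \<one> y x] not_descent_one that
      by simp
  qed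
  have "\<delta> c e = wprod [s, t]"
    using red[of s t] assms cd de by (intro delta_path) auto
  also have "\<dots> = wprod [t, s]" using assms(4) cd de by simp
  finally have "path [t, s] c e"
    using delta_iff_path[OF red[of t s] cd(1) de(2)] assms cd de by simp
  then show ?thesis using that by auto
qed

section \<open>Parallel chambers\<close>

text \<open>
  In the usual notation \<open>s\<^sup>\<bottom>\<close> is the set of letters different from \<open>s\<close> that commute with \<open>s\<close>. Parallel
  chambers are those in the same residue of type \<open>s\<^sup>\<bottom>\<close>; a wall residue is a residue of type
  \<open>{s} \<union> s\<^sup>\<bottom>\<close>. The latter is the product of an \<open>s\<close>-panel and a residue of type \<open>s\<^sup>\<bottom>\<close>, which is the
  content of the lemmas that follow.
\<close>

definition commuting_adj :: "'w \<Rightarrow> 'c \<Rightarrow> 'c \<Rightarrow> bool" where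
  "commuting_adj s c d \<longleftrightarrow> (\<exists>t. t \<noteq> s \<and> s \<otimes> t = t \<otimes> s \<and> adj t c d)"

definition parallel :: "'w \<Rightarrow> 'c \<Rightarrow> 'c \<Rightarrow> bool" where
  "parallel s = (commuting_adj s)\<^sup>*\<^sup>*"

definition wall_residue :: "'w \<Rightarrow> 'c \<Rightarrow> 'c \<Rightarrow> bool" where
  "wall_residue s = (\<lambda>c d. adj s c d \<or> commuting_adj s c d)\<^sup>*\<^sup>*"

lemma commuting_adj_sym: "commuting_adj s c d \<Longrightarrow> commuting_adj s d c"
  using adj_sym unfolding commuting_adj_def by blast

lemma commuting_adj_chambers: "commuting_adj s c d \<Longrightarrow> c \<in> Ch \<and> d \<in> Ch"
  using adj_chambers unfolding commuting_adj_def by blast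

lemma parallel_refl: "parallel s c c"
  by (simp add: parallel_def)

lemma parallel_trans: "parallel s c d \<Longrightarrow> parallel s d e \<Longrightarrow> parallel s c e"
  unfolding parallel_def by (rule rtranclp_trans)

lemma parallel_sym: "parallel s c d \<Longrightarrow> parallel s d c"
  unfolding parallel_def
  by (rule sympD[OF symp_rtranclp]) (auto intro: sympI commuting_adj_sym)

lemma wall_residue_refl: "wall_residue s c c"
  by (simp add: wall_residue_def)

lemma wall_residue_trans: "wall_residue s c d \<Longrightarrow> wall_residue s d e \<Longrightarrow> wall_residue s c e"
  unfolding wall_residue_def by (rule rtranclp_trans)

lemma wall_residue_sym: "wall_residue s c d \<Longrightarrow> wall_residue s d c"
  unfolding wall_residue_def
  by (rule sympD[OF symp_rtranclp]) (auto intro!: sympI intro: commuting_adj_sym adj_sym)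

lemma wall_residue_adj: "adj s c d \<Longrightarrow> wall_residue s c d"
  and wall_residue_commuting_adj: "commuting_adj s c d \<Longrightarrow> wall_residue s c d"
  unfolding wall_residue_def by (auto intro!: r_into_rtranclp)

lemma wall_residue_chamber: "wall_residue s c d \<Longrightarrow> c \<in> Ch \<Longrightarrow> d \<in> Ch"
  unfolding wall_residue_def
  by (induction rule: rtranclp_induct) (auto dest: adj_chambers commuting_adj_chambers)

lemma commuting_adj_descent:
  assumes "commuting_adj s c d" "b \<in> Ch" "s \<in> S"
  shows "descent (\<delta> b c) s \<longleftrightarrow> descent (\<delta> b d) s"
  using assms descent_adj_commuting unfolding commuting_adj_def by metis

lemma parallel_descent:
  assumes "parallel s c d" "b \<in> Ch" "s \<in> S"
  shows "descent (\<delta> b c) s \<longleftrightarrow> descent (\<delta> b d) s"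
  using assms(1) unfolding parallel_def
  by (induction rule: rtranclp_induct) (auto simp: commuting_adj_descent assms(2,3))

text \<open>
  Seen from \<open>c\<close>, no chamber parallel to \<open>c\<close> has the descent \<open>s\<close>, but the other chambers of its
  \<open>s\<close>-panel do.
\<close>

lemma parallel_in_panel_eq:
  assumes c: "c \<in> Ch" "s \<in> S" and p: "parallel s c d" and d: "d \<in> panel s c"
  shows "c = d"
proof (rule ccontr)
  assume "c \<noteq> d"
  then have "adj s c d" using mem_panel_iff[OF c] d by auto
  moreover have "\<not> descent (\<delta> c c) s" using c by (simp add: delta_self not_descent_one)
  ultimately have "descent (\<delta> c d) s" using descent_after_ascent c by blast
  then show False using parallel_descent[OF p c] c by (simp add: delta_self not_descent_one)
qed

text \<open>
  A ladder of squares.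
\<close>

lemma parallel_transport:
  assumes "parallel s p c" "adj s c d"
  shows "\<exists>q. adj s p q \<and> parallel s q d"
  using assms(1) unfolding parallel_def
proof (induction rule: converse_rtranclp_induct)
  case base
  then show ?case using assms(2) by auto
next
  case (step p p')
  then obtain q' where q': "adj s p' q'" "(commuting_adj s)\<^sup>*\<^sup>* q' d" by blast
  obtain t where t: "t \<noteq> s" "s \<otimes> t = t \<otimes> s" "adj t p p'"
    using step(1) unfolding commuting_adj_def by blast
  obtain q where "adj s p q" "adj t q q'" using square[OF t(3) q'(1) t(1)] t(2) by metis
  then have "adj s p q" "commuting_adj s q q'" using t unfolding commuting_adj_def by blast+
  then show ?case using q'(2) by (meson converse_rtranclp_into_rtranclp)
qed

lemma wall_residue_meets_panel:
  assumes "wall_residue s d c" and d: "d \<in> Ch" "s \<in> S"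
  shows "\<exists>p\<in>panel s d. parallel s p c"
  using assms(1) unfolding wall_residue_def
proof (induction rule: rtranclp_induct)
  case base
  then show ?case using panel_refl parallel_refl by blast
next
  case (step x y)
  then obtain p where p: "p \<in> panel s d" "parallel s p x" by blast
  from step(2) show ?case
  proof
    assume "adj s x y"
    then obtain q where q: "adj s p q" "parallel s q y" using parallel_transport p by blast
    then have "q \<in> panel s p" using mem_panel_iff adj_chambers by blast
    then show ?thesis using q panel_cong[OF d p(1)] by blast
  next
    assume "commuting_adj s x y"
    then have "parallel s x y" unfolding parallel_def by blast
    then show ?thesis using p parallel_trans by blast
  qed
qed

lemma panel_gate:
  assumes b: "b \<in> Ch" and d: "d \<in> Ch" and s: "s \<in> S"
  obtains x where "x \<in> panel s d" "\<And>y. y \<in> panel s d \<Longrightarrow> descent (\<delta> b y) s \<longleftrightarrow> y \<noteq> x"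
proof -
  have "\<exists>x\<in>panel s d. \<not> descent (\<delta> b x) s"
  proof (cases "descent (\<delta> b d) s")
    case True
    then obtain e where "adj s e d" "\<not> descent (\<delta> b e) s" using gate_exists b d by blast
    then show ?thesis using mem_panel_iff[OF d s] adj_sym by blast
  next
    case False
    then show ?thesis using panel_refl by blast
  qed
  then obtain x where x: "x \<in> panel s d" "\<not> descent (\<delta> b x) s" by blast
  have "descent (\<delta> b y) s" if "y \<in> panel s d" "y \<noteq> x" for y
    using descent_after_ascent[OF b panel_complete[OF d s x(1) that(1)]] x(2) that(2) by blast
  then show ?thesis using that x by blast
qed

end

section \<open>Colourings\<close>

locale based_ra_building = ra_building W S \<Delta> \<delta>
  for W :: "('w, 'x) monoid_scheme" (structure) and S :: "'w set"
    and \<Delta> :: "('c, 'w) coloured_graph" and \<delta> :: "'c \<Rightarrow> 'c \<Rightarrow> 'w" +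
  fixes c0 :: 'c
  assumes base: "c0 \<in> chambers \<Delta>" and regular: "semi_regular S \<Delta>"
begin

abbreviation pos :: "'c \<Rightarrow> 'w" where "pos c \<equiv> \<delta> c0 c"

text \<open>
  Colours for the \<open>s\<close>-panels, taken from the \<open>s\<close>-panel of the base chamber. The colour \<open>c0\<close> is
  reserved for the gates.
\<close>

definition wall_colouring :: "'w \<Rightarrow> ('c \<Rightarrow> 'c) \<Rightarrow> bool" where
  "wall_colouring s f \<longleftrightarrow>
     (\<forall>c\<in>Ch. bij_betw f (panel s c) (panel s c0)) \<and>
     (\<forall>c d. commuting_adj s c d \<longrightarrow> f c = f d) \<and>
     (\<forall>c\<in>Ch. f c = c0 \<longleftrightarrow> \<not> descent (pos c) s)"

text \<open>
  Semi-regularity gives some bijection; a transposition of colours gives the gate its colour.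
\<close>

lemma panel_colouring:
  assumes d: "d \<in> Ch" and s: "s \<in> S"
  obtains f where "bij_betw f (panel s d) (panel s c0)"
    "\<And>x. x \<in> panel s d \<Longrightarrow> f x = c0 \<longleftrightarrow> \<not> descent (pos x) s"
proof -
  have "panel s d \<approx> panel s c0"
    using regular d base s panel_in_panels unfolding semi_regular_def by blast
  then obtain f where f: "bij_betw f (panel s d) (panel s c0)" unfolding eqpoll_def by blast
  obtain x where x: "x \<in> panel s d" "\<And>y. y \<in> panel s d \<Longrightarrow> descent (pos y) s \<longleftrightarrow> y \<noteq> x"
    using panel_gate[OF base d s] by blast
  define g where "g = Transposition.transpose (f x) c0 \<circ> f"
  have fx: "f x \<in> panel s c0" using f x(1) bij_betwE by blast
  have g: "bij_betw g (panel s d) (panel s c0)"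
    unfolding g_def using f fx panel_refl[of c0 s]
    by (auto intro!: bij_betw_trans)
  have "g x = c0" by (simp add: g_def)
  then have "g y = c0 \<longleftrightarrow> \<not> descent (pos y) s" if "y \<in> panel s d" for y
    using x that bij_betw_imp_inj_on[OF g] by (metis inj_onD)
  with g show ?thesis using that by blast
qed

text \<open>
  In each wall residue, colour one \<open>s\<close>-panel and spread its colours along parallel chambers. This is
  consistent because every chamber of the wall residue is parallel to exactly one chamber of the
  chosen panel, and it respects gates because parallel chambers share the descent \<open>s\<close>.
\<close>

lemma wall_colouring_exists:
  assumes s: "s \<in> S" shows "\<exists>f. wall_colouring s f"
proof -
  define rep where "rep c = (SOME d. wall_residue s c d)" for c
  have rep: "wall_residue s c (rep c)" for c
    unfolding rep_def using wall_residue_refl by (rule someI)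
  have rep_cong: "rep c = rep d" if "wall_residue s c d" for c d
  proof -
    have "wall_residue s c = wall_residue s d"
      using that wall_residue_sym wall_residue_trans by blast
    then show ?thesis by (simp add: rep_def)
  qed
  have rep_ch: "rep c \<in> Ch" if "c \<in> Ch" for c
    using wall_residue_chamber rep that by blast
  have "\<exists>\<beta>. bij_betw \<beta> (panel s d) (panel s c0) \<and>
      (\<forall>x\<in>panel s d. \<beta> x = c0 \<longleftrightarrow> \<not> descent (pos x) s)" if "d \<in> Ch" for d
    using panel_colouring[OF that s] by metis
  then obtain \<beta> where \<beta>: "\<And>d. d \<in> Ch \<Longrightarrow> bij_betw (\<beta> d) (panel s d) (panel s c0)"
    "\<And>d x. d \<in> Ch \<Longrightarrow> x \<in> panel s d \<Longrightarrow> \<beta> d x = c0 \<longleftrightarrow> \<not> descent (pos x) s"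
    by metis
  \<comment> \<open>The chamber parallel to \<open>c\<close> in the chosen panel.\<close>
  define shadow where "shadow c = (THE p. p \<in> panel s (rep c) \<and> parallel s p c)" for c
  have shadow_eq: "shadow c = p" if "c \<in> Ch" "p \<in> panel s (rep c)" "parallel s p c" for c p
    unfolding shadow_def
  proof (rule the_equality)
    fix q assume q: "q \<in> panel s (rep c) \<and> parallel s q c"
    have "p \<in> Ch" using panel_subset rep_ch that s by blast
    moreover have "q \<in> panel s p" using panel_cong rep_ch that q s by blast
    moreover have "parallel s p q" using that q parallel_sym parallel_trans by blast
    ultimately show "q = p" using parallel_in_panel_eq s by blast
  qed (use that in simp)
  have shadow: "shadow c \<in> panel s (rep c) \<and> parallel s (shadow c) c" if c: "c \<in> Ch" for c
  proof -
    obtain p where "p \<in> panel s (rep c)" "parallel s p c"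
      using wall_residue_meets_panel[OF wall_residue_sym[OF rep] rep_ch[OF c] s] by blast
    then show ?thesis using shadow_eq c by simp
  qed
  define f where "f c = \<beta> (rep c) (shadow c)" for c
  have "bij_betw f (panel s c) (panel s c0)" if c: "c \<in> Ch" for c
  proof -
    have same: "rep d = rep c" "d \<in> Ch" if "d \<in> panel s c" for d
    proof -
      show "d \<in> Ch" using that panel_subset[OF c s] by blast
      show "rep d = rep c" using that mem_panel_iff[OF c s] wall_residue_adj rep_cong by metis
    qed
    have "bij_betw shadow (panel s c) (panel s (rep c))"
    proof (rule bij_betwI')
      fix d e assume d: "d \<in> panel s c" and e: "e \<in> panel s c"
      show "shadow d = shadow e \<longleftrightarrow> d = e"
      proof
        assume "shadow d = shadow e"
        then have "parallel s d e"
          using shadow same d e parallel_sym parallel_trans by metis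
        then show "d = e" using parallel_in_panel_eq[OF _ s] same d e panel_cong[OF c s] by blast
      qed simp
    next
      fix d assume "d \<in> panel s c"
      then show "shadow d \<in> panel s (rep c)" using shadow same by metis
    next
      fix p assume p: "p \<in> panel s (rep c)"
      then have pc: "p \<in> Ch" using panel_subset rep_ch c s by blast
      have "wall_residue s (rep c) p"
        using p mem_panel_iff[OF rep_ch[OF c] s] wall_residue_adj wall_residue_refl by metis
      then have "wall_residue s c p" using rep wall_residue_trans by blast
      then obtain d where d: "d \<in> panel s c" "parallel s d p"
        using wall_residue_meets_panel c s by blast
      then have "shadow d = p" using shadow_eq same p parallel_sym by metis
      then show "\<exists>d\<in>panel s c. p = shadow d" using d by blast
    qed
    then have "bij_betw (\<beta> (rep c) \<circ> shadow) (panel s c) (panel s c0)"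
      using \<beta>(1) rep_ch[OF c] bij_betw_trans by blast
    then show ?thesis
      by (rule bij_betw_cong[THEN iffD1, rotated]) (simp add: f_def same)
  qed
  moreover have "f c = f d" if "commuting_adj s c d" for c d
  proof -
    have r: "rep c = rep d" using that wall_residue_commuting_adj rep_cong by blast
    have ch: "c \<in> Ch" "d \<in> Ch" using commuting_adj_chambers that by auto
    have "parallel s c d" using that unfolding parallel_def by blast
    then have "parallel s (shadow c) d" using shadow[OF ch(1)] parallel_trans by blast
    then have "shadow d = shadow c" using shadow_eq[OF ch(2)] shadow[OF ch(1)] r by simp
    then show ?thesis by (simp add: f_def r)
  qed
  moreover have "f c = c0 \<longleftrightarrow> \<not> descent (pos c) s" if "c \<in> Ch" for c
    using \<beta>(2)[OF rep_ch[OF that]] shadow[OF that] parallel_descent[OF _ base s]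
    unfolding f_def by metis
  ultimately show ?thesis unfolding wall_colouring_def by blast
qed

definition colouring :: "('w \<Rightarrow> 'c \<Rightarrow> 'c) \<Rightarrow> bool" where
  "colouring h \<longleftrightarrow> (\<forall>s\<in>S. wall_colouring s (h s))"

lemma colouring_exists: obtains h where "colouring h"
  using wall_colouring_exists unfolding colouring_def by metis

lemma colouring_inj:
  "colouring h \<Longrightarrow> adj s c d \<Longrightarrow> h s c \<noteq> h s d"
  using adj_chambers[of s c d] mem_panel_iff[of c s d] panel_refl[of c s]
  unfolding colouring_def wall_colouring_def bij_betw_def inj_on_def by metis

lemma colouring_commuting:
  "colouring h \<Longrightarrow> s \<in> S \<Longrightarrow> adj t c d \<Longrightarrow> t \<noteq> s \<Longrightarrow> s \<otimes> t = t \<otimes> s \<Longrightarrow> h s c = h s d"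
  unfolding colouring_def wall_colouring_def commuting_adj_def by blast

lemma colouring_gate:
  "colouring h \<Longrightarrow> s \<in> S \<Longrightarrow> c \<in> Ch \<Longrightarrow> h s c = c0 \<longleftrightarrow> \<not> descent (pos c) s"
  unfolding colouring_def wall_colouring_def by blast

lemma colouring_surj:
  assumes "colouring h" "s \<in> S" "c \<in> Ch" "y \<in> panel s c0"
  shows "\<exists>d\<in>panel s c. h s d = y"
  using assms unfolding colouring_def wall_colouring_def bij_betw_def by (metis image_iff)

lemma colouring_range:
  assumes "colouring h" "s \<in> S" "c \<in> Ch" shows "h s c \<in> panel s c0"
  using assms panel_refl unfolding colouring_def wall_colouring_def by (metis bij_betwE)

section \<open>The automorphism between two colourings\<close>

text \<open>
  Two chambers are matched if they are the ends of two minimal galleries from \<open>c0\<close> of the same type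
  such that the colours read off the first one by \<open>h\<close> are those read off the second one by \<open>k\<close>. The
  definition is symmetric under exchanging \<open>h\<close> and \<open>k\<close>, so that functionality of the relation is also
  its injectivity.
\<close>

inductive matched :: "('w \<Rightarrow> 'c \<Rightarrow> 'c) \<Rightarrow> ('w \<Rightarrow> 'c \<Rightarrow> 'c) \<Rightarrow> 'c \<Rightarrow> 'c \<Rightarrow> bool" for h k where
  matched_base: "matched h k c0 c0"
| matched_step: "\<lbrakk>matched h k c d; adj s c c'; adj s d d'; h s c = c0; k s d = c0; h s c' = k s d'\<rbrakk>
    \<Longrightarrow> matched h k c' d'"

lemma matched_sym: "matched h k c d \<Longrightarrow> matched k h d c"
proof (induction rule: matched.induct)
  case (matched_step c d s c' d')
  show ?case
    by (rule matched.matched_step[where s = s and c = d and d = c]) (use matched_step in simp_all)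
qed (rule matched_base)

lemma matched_chambers: "matched h k c d \<Longrightarrow> c \<in> Ch \<and> d \<in> Ch"
  by (induction rule: matched.induct) (auto simp: base dest: adj_chambers)

lemma matched_pos:
  assumes "colouring h" "colouring k" "matched h k c d" shows "pos c = pos d"
  using assms(3)
proof (induction rule: matched.induct)
  case (matched_step c d s c' d')
  have "\<not> descent (pos c) s" "\<not> descent (pos d) s"
    using colouring_gate assms(1,2) matched_step.hyps adj_chambers by metis+
  then show ?case using delta_ascent[OF base] matched_step by metis
qed simp

lemma descent_chamber_induct [consumes 1, case_names root step]:
  assumes "c \<in> Ch" "P c0"
    and step: "\<And>c s e. c \<in> Ch \<Longrightarrow> descent (pos c) s \<Longrightarrow> adj s e c \<Longrightarrow> \<not> descent (pos e) s \<Longrightarrow>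
      P e \<Longrightarrow> P c"
  shows "P c"
  using assms(1)
proof (induction "len (pos c)" arbitrary: c rule: less_induct)
  case less
  show ?case
  proof (cases "c = c0")
    case False
    then have "pos c \<noteq> \<one>" using delta_one base less.prems by blast
    then obtain s where s: "descent (pos c) s" using descent_exists base less.prems by blast
    then obtain e where e: "adj s e c" "pos e = pos c \<otimes> s" "\<not> descent (pos e) s"
      using gate_exists base less.prems by blast
    have "len (pos e) < len (pos c)" using s e(2) by (simp add: descent_def)
    then show ?thesis using step less s e adj_chambers[OF e(1)] by blast
  qed (use assms(2) in simp)
qed

lemma matched_total:
  assumes h: "colouring h" and k: "colouring k" and c: "c \<in> Ch"
  shows "\<exists>d. matched h k c d"
  using c
proof (induction rule: descent_chamber_induct)
  case root
  then show ?case using matched_base by blast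
next
  case (step c s e)
  then obtain d where d: "matched h k e d" by blast
  note ec = adj_chambers[OF step(3)]
  have dc: "d \<in> Ch" using matched_chambers d by blast
  have he: "h s e = c0" using colouring_gate h ec step by blast
  have "\<not> descent (pos d) s" using matched_pos[OF h k d] step by simp
  then have kd: "k s d = c0" using colouring_gate k ec dc by blast
  obtain d' where d': "d' \<in> panel s d" "k s d' = h s c"
    using colouring_surj[OF k ec(4) dc] colouring_range[OF h ec(4,2)] by blast
  have "h s c \<noteq> c0" using colouring_inj[OF h step(3)] he by simp
  then have "adj s d d'" using d' kd mem_panel_iff[OF dc ec(4)] by auto
  then show ?case using matched_step d step(3) he kd d' by metis
qed

text \<open>
  The relation does not depend on the minimal gallery: any descent \<open>s\<close> may be taken as the last step
  of the gallery to \<open>c\<close>. If the last step was \<open>t \<noteq> s\<close>, then \<open>s\<close> and \<open>t\<close> commute, and the last two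
  steps span a square on both sides. Opposite sides of a square have the same colours, so the two
  steps may be interchanged.
\<close>

lemma matched_descent:
  assumes h: "colouring h" and k: "colouring k" and m: "matched h k c d"
    and ds: "descent (pos c) s" and e: "adj s e c" "\<not> descent (pos e) s"
  shows "\<exists>d'. matched h k e d' \<and> adj s d' d \<and> k s d = h s c"
  using m ds e
proof (induction arbitrary: s e rule: matched.induct)
  case matched_base
  then show ?case using base not_descent_one by (simp add: delta_self)
next
  case (matched_step c d t c' d')
  note cc = adj_chambers[OF matched_step(2)] and dd = adj_chambers[OF matched_step(3)]
  note ee = adj_chambers[OF \<open>adj s e c'\<close>]
  have ntc: "\<not> descent (pos c) t" using colouring_gate h matched_step cc by blast
  then have dtc': "descent (pos c') t" using descent_after_ascent base matched_step by blast
  show ?case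
  proof (cases "s = t")
    case True
    have "c = e"
    proof (rule ccontr)
      assume "c \<noteq> e"
      then have "adj s c e" using adj_trans matched_step(2) adj_sym matched_step(9) True by blast
      then show False using descent_after_ascent base ntc True matched_step(10) by blast
    qed
    then show ?thesis using matched_step True by metis
  next
    case False
    have comm: "s \<otimes> t = t \<otimes> s"
      using descents_commute[of "pos c'"] matched_step(8) dtc' base cc by blast
    have dsc: "descent (pos c) s"
      using descent_adj_commuting[OF base matched_step(2) ee(4) False comm] matched_step(8) by simp
    obtain f where f: "adj s f c" "\<not> descent (pos f) s"
      using gate_exists[OF base cc(1) dsc] by blast
    note ff = adj_chambers[OF f(1)]
    obtain d1 where d1: "matched h k f d1" "adj s d1 d" "k s d = h s c"
      using matched_step.IH[OF dsc f] by blast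
    note dd1 = adj_chambers[OF d1(2)]
    \<comment> \<open>The fourth corner of the square over \<open>f\<close>, \<open>c\<close>, \<open>c'\<close> is the gate \<open>e\<close>.\<close>
    obtain e' where e': "adj t f e'" "adj s e' c'"
      using square[OF f(1) matched_step(2) False comm] by blast
    have "\<not> descent (pos e') s"
      using descent_adj_commuting[OF base e'(1) ee(4) False comm] f(2) by simp
    have "e' = e"
    proof (rule ccontr)
      assume "e' \<noteq> e"
      then have "adj s e' e" using adj_trans e'(2) adj_sym matched_step(9) by blast
      then show False using descent_after_ascent base \<open>\<not> descent (pos e') s\<close> matched_step(10)
        by blast
    qed
    with e' have fe: "adj t f e" by simp
    obtain d2 where d2: "adj t d1 d2" "adj s d2 d'"
      using square[OF d1(2) matched_step(3) False comm] by blast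
    have t: "t \<in> S" "t \<noteq> s" "t \<otimes> s = s \<otimes> t" using cc False comm by auto
    have 1: "h t f = c0" using colouring_commuting[OF h t(1) f(1) _ t(3)] False matched_step(4) by simp
    have 2: "k t d1 = c0" using colouring_commuting[OF k t(1) d1(2) _ t(3)] False matched_step(5) by simp
    have 3: "h t e = k t d2"
      using colouring_commuting[OF h t(1) matched_step(9) _ t(3)]
        colouring_commuting[OF k t(1) d2(2) _ t(3)] False matched_step(6) by simp
    have "matched h k e d2" using matched.matched_step[OF d1(1) fe d2(1) 1 2 3] .
    moreover have "k s d' = h s c'"
      using colouring_commuting[OF h ee(4) matched_step(2) t(2) comm]
        colouring_commuting[OF k ee(4) matched_step(3) t(2) comm] d1(3) by simp
    ultimately show ?thesis using d2(2) by blast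
  qed
qed

lemma matched_colour:
  assumes h: "colouring h" and k: "colouring k" and m: "matched h k c d" and s: "s \<in> S"
  shows "k s d = h s c"
proof (cases "descent (pos c) s")
  case True
  have "c \<in> Ch" using matched_chambers[OF m] by simp
  from gate_exists[OF base this True] obtain e where "adj s e c" "\<not> descent (pos e) s" .
  then show ?thesis using matched_descent[OF h k m True] by blast
next
  case False
  then show ?thesis
    using colouring_gate[OF h s, of c] colouring_gate[OF k s, of d] matched_pos[OF h k m]
      matched_chambers[OF m] by simp
qed

lemma matched_functional:
  assumes h: "colouring h" and k: "colouring k" and m: "matched h k c d" "matched h k c d'"
  shows "d = d'"
proof -
  have "c \<in> Ch" using matched_chambers m by blast
  then show ?thesis using m
  proof (induction arbitrary: d d' rule: descent_chamber_induct)
    case root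
    have "pos x = \<one> \<and> x \<in> Ch" if "matched h k c0 x" for x
      using matched_pos[OF h k that] matched_chambers[OF that] by (simp add: delta_self)
    then show ?case using root delta_one[OF base] by metis
  next
    case (step c s e)
    obtain x where x: "matched h k e x" "adj s x d" "k s d = h s c"
      using matched_descent[OF h k step(6,2-4)] by blast
    obtain x' where x': "matched h k e x'" "adj s x' d'" "k s d' = h s c"
      using matched_descent[OF h k step(7,2-4)] by blast
    have "x = x'" using step(5) x x' by blast
    show ?case
    proof (rule ccontr)
      assume "d \<noteq> d'"
      then have "adj s d d'" using adj_trans[of s d x d'] adj_sym x(2) x'(2) \<open>x = x'\<close> by blast
      then show False using colouring_inj[OF k] x(3) x'(3) by metis
    qed
  qed
qed

text \<open>
  Both chambers lie in the \<open>s\<close>-panel of the chamber that is matched with their common gate.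
\<close>

lemma matched_adj:
  assumes h: "colouring h" and k: "colouring k" and m: "matched h k c d" "matched h k c' d'"
    and a: "adj s c c'"
  shows "adj s d d'"
proof -
  note cc = adj_chambers[OF a]
  have dd: "d \<in> Ch" "d' \<in> Ch" using matched_chambers m by blast+
  obtain e where e: "e \<in> panel s c" "\<And>y. y \<in> panel s c \<Longrightarrow> descent (pos y) s \<longleftrightarrow> y \<noteq> e"
    using panel_gate[OF base cc(1,4)] by blast
  then have ec: "e \<in> Ch" using panel_subset cc by blast
  obtain f where f: "matched h k e f" using matched_total[OF h k ec] by blast
  have "x \<in> panel s f" if y: "y \<in> panel s c" "matched h k y x" for x y
  proof (cases "y = e")
    case True
    then show ?thesis using matched_functional[OF h k f] y panel_refl by blast
  next
    case False
    then have "descent (pos y) s" "\<not> descent (pos e) s" "adj s e y"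
      using e y panel_complete[OF cc(1,4) e(1) y(1)] by auto
    then obtain f' where "matched h k e f'" "adj s f' x"
      using matched_descent[OF h k y(2)] by blast
    then show ?thesis
      using matched_functional[OF h k f] mem_panel_iff[of f s x] adj_chambers[of s f' x] by blast
  qed
  then have "d \<in> panel s f" "d' \<in> panel s f"
    using m a mem_panel_iff[OF cc(1,4)] by blast+
  moreover have "d \<noteq> d'"
    using matched_functional[OF k h] matched_sym m cc(3) by blast
  ultimately show ?thesis using panel_complete cc(4) f matched_chambers by blast
qed

text \<open>
  A chamber is determined by the colours along a minimal gallery from \<open>c0\<close>, and any two colourings
  use the same system of coordinates; the automorphism takes the coordinates given by \<open>h\<close> to those
  given by \<open>k\<close>.
\<close>

lemma recolouring_automorphism:
  assumes h: "colouring h" and k: "colouring k"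
  obtains g where "g \<in> Aut \<Delta>" "\<And>c. c \<in> Ch \<Longrightarrow> matched h k c (g c)"
proof -
  define g where "g = (\<lambda>c\<in>Ch. THE d. matched h k c d)"
  have g: "matched h k c (g c)" if "c \<in> Ch" for c
  proof -
    have "\<exists>!d. matched h k c d"
      using matched_total[OF h k that] matched_functional[OF h k] by blast
    then show ?thesis unfolding g_def using that by (simp add: theI')
  qed
  have "bij_betw g Ch Ch"
  proof (rule bij_betwI')
    fix c d assume "c \<in> Ch" "d \<in> Ch"
    then show "g c = g d \<longleftrightarrow> c = d" using g matched_sym matched_functional[OF k h] by metis
  next
    fix c assume "c \<in> Ch"
    then show "g c \<in> Ch" using g matched_chambers by blast
  next
    fix d assume "d \<in> Ch"
    then obtain c where "matched k h d c" using matched_total[OF k h] by blast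
    then have "matched h k c d" "c \<in> Ch" using matched_sym matched_chambers by blast+
    then show "\<exists>c\<in>Ch. d = g c" using g matched_functional[OF h k] by blast
  qed
  moreover have "adj s (g c) (g d) \<longleftrightarrow> adj s c d" if "c \<in> Ch" "d \<in> Ch" for s c d
    using matched_adj[OF h k g[OF that(1)] g[OF that(2)]]
      matched_adj[OF k h matched_sym[OF g[OF that(1)]] matched_sym[OF g[OF that(2)]]] by blast
  ultimately have "g \<in> Aut \<Delta>" unfolding Aut_def Bij_def g_def by auto
  then show ?thesis using that g by blast
qed


section \<open>Flexible chambers\<close>

definition on_geodesic :: "'c \<Rightarrow> 'c \<Rightarrow> bool" where
  "on_geodesic e c \<longleftrightarrow> (\<exists>v. path v e c \<and> len (pos c) = len (pos e) + length v)"

lemma on_geodesic_chambers: "on_geodesic e c \<Longrightarrow> e \<in> Ch \<and> c \<in> Ch"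
  using path_chambers unfolding on_geodesic_def by blast

lemma on_geodesic_refl: "c \<in> Ch \<Longrightarrow> on_geodesic c c"
  unfolding on_geodesic_def by (intro exI[of _ "[]"]) simp

lemma on_geodesic_trans:
  assumes "on_geodesic e d" "on_geodesic d c" shows "on_geodesic e c"
proof -
  obtain u v where "path u e d" "len (pos d) = len (pos e) + length u"
    "path v d c" "len (pos c) = len (pos d) + length v"
    using assms unfolding on_geodesic_def by blast
  then show ?thesis unfolding on_geodesic_def path_append
    by (intro exI[of _ "u @ v"]) (auto simp: path_append)
qed

lemma gate_on_geodesic:
  assumes "adj s e c" "\<not> descent (pos e) s"
  shows "on_geodesic e c" "len (pos c) = Suc (len (pos e))"
proof -
  note ch = adj_chambers[OF assms(1)]
  show *: "len (pos c) = Suc (len (pos e))"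
    using delta_ascent[OF base assms] len_ascent[of "pos e" s] assms ch base by simp
  have "path [s] e c" using assms ch by simp
  then show "on_geodesic e c" unfolding on_geodesic_def using * by (intro exI[of _ "[s]"]) simp
qed

lemma minimal_gallery_iff:
  assumes c: "c \<in> Ch"
  shows "minimal_gallery \<Delta> c0 c cs \<longleftrightarrow>
    (\<exists>u. gallery_of_type \<Delta> u c0 c cs \<and> length u = len (pos c))"
proof
  assume m: "minimal_gallery \<Delta> c0 c cs"
  then obtain u where u: "gallery_of_type \<Delta> u c0 c cs"
    unfolding minimal_gallery_def gallery_def by blast
  obtain v where v: "reduced v" "wprod v = pos c" "path v c0 c"
    using reduced_path_exists[OF base c] by blast
  obtain cs' where cs': "gallery_of_type \<Delta> v c0 c cs'" using gallery_iff_path v(3) by blast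
  then have "length cs \<le> length cs'" using m unfolding minimal_gallery_def gallery_def by blast
  then have "length u \<le> len (pos c)"
    using u cs' reduced_length[OF v(1)] v(2) by (simp add: gallery_of_type_def)
  moreover have "len (pos c) \<le> length u" using u gallery_iff_path len_delta_le by blast
  ultimately show "\<exists>u. gallery_of_type \<Delta> u c0 c cs \<and> length u = len (pos c)" using u by auto
next
  assume "\<exists>u. gallery_of_type \<Delta> u c0 c cs \<and> length u = len (pos c)"
  then obtain u where u: "gallery_of_type \<Delta> u c0 c cs" "length u = len (pos c)" by blast
  have "length cs \<le> length cs'" if "gallery_of_type \<Delta> v c0 c cs'" for v cs'
    using that u gallery_iff_path[of v c0 c] len_delta_le[of v c0 c]
    by (auto simp: gallery_of_type_def)
  then show "minimal_gallery \<Delta> c0 c cs"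
    using u unfolding minimal_gallery_def gallery_def by blast
qed

lemma minimal_gallery_on_geodesic:
  assumes c: "c \<in> Ch" and m: "minimal_gallery \<Delta> c0 c cs" and i: "i < length cs"
  shows "on_geodesic (cs ! i) c" "len (pos (cs ! i)) = i"
proof -
  obtain u where u: "gallery_of_type \<Delta> u c0 c cs" "length u = len (pos c)"
    using minimal_gallery_iff[OF c] m by blast
  have i': "i \<le> length u" using i u by (simp add: gallery_of_type_def)
  have le: "len (pos (cs ! i)) \<le> i"
    using len_delta_le[OF gallery_take[OF u(1) i']] i' by simp
  have p: "path (drop i u) (cs ! i) c" using gallery_drop[OF u(1) i'] .
  then have "len (pos c) \<le> len (pos (cs ! i)) + (length u - i)"
    using len_delta_path[OF p base] by simp
  then show eq: "len (pos (cs ! i)) = i" using le u(2) i' by simp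
  show "on_geodesic (cs ! i) c"
    unfolding on_geodesic_def using p eq u(2) i' by (intro exI[of _ "drop i u"]) simp
qed

lemma geodesic_on_minimal_gallery:
  assumes "on_geodesic e c"
  obtains cs where "minimal_gallery \<Delta> c0 c cs" "len (pos e) < length cs" "cs ! len (pos e) = e"
proof -
  obtain v where v: "path v e c" "len (pos c) = len (pos e) + length v"
    using assms unfolding on_geodesic_def by blast
  have ch: "e \<in> Ch" "c \<in> Ch" using on_geodesic_chambers[OF assms] by auto
  obtain u where u: "reduced u" "wprod u = pos e" "path u c0 e"
    using reduced_path_exists[OF base ch(1)] .
  have l: "length u = len (pos e)" using reduced_length u by metis
  obtain cs where cs: "gallery_of_type \<Delta> (u @ v) c0 c cs" "cs ! length u = e"
    using gallery_through[OF u(3) v(1)] by blast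
  have "minimal_gallery \<Delta> c0 c cs"
    unfolding minimal_gallery_iff[OF ch(2)] using cs(1) l v(2) by (intro exI[of _ "u @ v"]) simp
  moreover have "len (pos e) < length cs" using cs(1) l by (simp add: gallery_of_type_def)
  ultimately show ?thesis using that cs(2) l by simp
qed

abbreviation ball :: "nat \<Rightarrow> 'c set" where "ball n \<equiv> chamber_ball W S \<Delta> \<delta> c0 n"
abbreviation flexible :: "nat \<Rightarrow> 'c set" where "flexible n \<equiv> Flex W S \<Delta> \<delta> c0 n"

lemma mem_ball_iff: "c \<in> ball n \<longleftrightarrow> c \<in> Ch \<and> len (pos c) \<le> n"
  by (simp add: chamber_ball_def gallery_dist_def)

text \<open>
  Inside the ball the condition holds because a chamber on a minimal gallery to \<open>c\<close> is no farther
  from \<open>c0\<close> than \<open>c\<close>.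
\<close>

lemma flexible_iff:
  "c \<in> flexible n \<longleftrightarrow>
     c \<in> Ch \<and> (\<forall>e. on_geodesic e c \<and> n < len (pos e) \<longrightarrow> \<not> firm W S (pos e))"
proof (cases "c \<in> Ch")
  case c: True
  have "c \<in> flexible n \<longleftrightarrow> len (pos c) \<le> n \<or>
      (\<forall>cs. minimal_gallery \<Delta> c0 c cs \<longrightarrow>
         (\<forall>i. n < i \<and> i < length cs \<longrightarrow> \<not> firm W S (pos (cs ! i))))"
    using c by (auto simp: Flex_def mem_ball_iff gallery_dist_def)
  also have "\<dots> \<longleftrightarrow> len (pos c) \<le> n \<or>
      (\<forall>e. on_geodesic e c \<and> n < len (pos e) \<longrightarrow> \<not> firm W S (pos e))"
    using minimal_gallery_on_geodesic[OF c] geodesic_on_minimal_gallery by metis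
  also have "\<dots> \<longleftrightarrow> (\<forall>e. on_geodesic e c \<and> n < len (pos e) \<longrightarrow> \<not> firm W S (pos e))"
    by (auto simp: on_geodesic_def)
  finally show ?thesis using c by simp
next
  case False
  then show ?thesis by (auto simp: Flex_def mem_ball_iff)
qed

lemma automorphism_adj:
  "g \<in> Aut \<Delta> \<Longrightarrow> adj s c d \<Longrightarrow> adj s (g c) (g d)"
  using adj_chambers[of s c d] unfolding Aut_def by blast

section \<open>Flexible chambers are fixed\<close>

text \<open>
  A flexible chamber \<open>c\<close> outside the ball has two different descents. The gates of the two
  corresponding panels are flexible and closer to \<open>c0\<close>, hence fixed. So both panels are preserved,
  and \<open>c\<close> is the only chamber that they have in common.
\<close>

lemma flexible_fixed:
  assumes c: "c \<in> flexible n" and g: "g \<in> Aut \<Delta>" and fix_ball: "\<And>x. x \<in> ball n \<Longrightarrow> g x = x"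
  shows "g c = c"
  using c
proof (induction "len (pos c)" arbitrary: c rule: less_induct)
  case less
  have c: "c \<in> Ch" using less.prems flexible_iff by blast
  show ?case
  proof (cases "len (pos c) \<le> n")
    case True
    then show ?thesis using fix_ball mem_ball_iff c by blast
  next
    case False
    then have nf: "\<not> firm W S (pos c)"
      using less.prems on_geodesic_refl[OF c] unfolding flexible_iff by auto
    have pc: "pos c \<in> carrier W" using base c by blast
    have "pos c \<noteq> \<one>" using False len_one by auto
    then obtain s where s: "descent (pos c) s" using descent_exists pc by blast
    then obtain t where t: "descent (pos c) t" "t \<noteq> s" using nf firm_iff[OF pc] by blast
    have gate: "\<exists>e. adj x e (g c) \<and> adj x e c" if x: "descent (pos c) x" for x
    proof -
      obtain e where e: "adj x e c" "\<not> descent (pos e) x" using gate_exists[OF base c x] by blast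
      note geo = gate_on_geodesic[OF e]
      have "e \<in> flexible n"
        using less.prems geo(1) on_geodesic_trans on_geodesic_chambers unfolding flexible_iff by blast
      then have "g e = e" using less.hyps geo(2) by simp
      then show ?thesis using automorphism_adj[OF g e(1)] e(1) by auto
    qed
    show ?thesis
    proof (rule ccontr)
      assume ne: "g c \<noteq> c"
      have "adj x c (g c)" if "descent (pos c) x" for x
        using gate[OF that] adj_sym adj_trans ne by metis
      then show False using s t adj_letter_unique by blast
    qed
  qed
qed

section \<open>Other chambers are moved\<close>

lemma wall_colouring_swap:
  assumes f: "wall_colouring s f" and s: "s \<in> S"
    and y: "y \<in> panel s c0" "z \<in> panel s c0" "y \<noteq> c0" "z \<noteq> c0"
  shows "wall_colouring s
    (\<lambda>c. if wall_residue s e c then Transposition.transpose y z (f c) else f c)" (is "wall_colouring s ?k")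
proof -
  have res: "wall_residue s e c \<longleftrightarrow> wall_residue s e d" if "wall_residue s c d" for c d
    using that wall_residue_sym wall_residue_trans by blast
  have "bij_betw ?k (panel s c) (panel s c0)" if c: "c \<in> Ch" for c
  proof -
    have f': "bij_betw f (panel s c) (panel s c0)" using f c unfolding wall_colouring_def by blast
    have "wall_residue s e d \<longleftrightarrow> wall_residue s e c" if "d \<in> panel s c" for d
      using that mem_panel_iff[OF c s] res[OF wall_residue_adj[of s c d]] by auto
    then have eq: "?k d = (if wall_residue s e c then Transposition.transpose y z \<circ> f else f) d"
      if "d \<in> panel s c" for d using that by simp
    have "bij_betw (Transposition.transpose y z \<circ> f) (panel s c) (panel s c0)"
      using f' y(1,2) by (auto intro!: bij_betw_trans)
    then have "bij_betw (if wall_residue s e c then Transposition.transpose y z \<circ> f else f)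
        (panel s c) (panel s c0)"
      using f' by simp
    then show ?thesis using bij_betw_cong[of "panel s c" ?k, OF eq] by blast
  qed
  moreover have "?k c = ?k d" if "commuting_adj s c d" for c d
    using that f res[OF wall_residue_commuting_adj[OF that]] unfolding wall_colouring_def by auto
  moreover have "?k c = c0 \<longleftrightarrow> f c = c0" for c
    using y(3,4) by (auto simp: Transposition.transpose_def)
  ultimately show ?thesis using f unfolding wall_colouring_def by simp
qed

text \<open>
  The gate \<open>q\<close> of the \<open>r\<close>-panel of \<open>e\<close> has no descent in \<open>J = {r} \<union> r\<^sup>\<bottom>\<close>: a descent in \<open>r\<^sup>\<bottom>\<close> would
  also be one of \<open>e\<close>. Hence \<open>q\<close> is closest to \<open>c0\<close> in the whole wall residue. A chamber \<open>c\<close> of this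
  residue with descent \<open>r\<close> is one step beyond its own gate, and \<open>e\<close> is one step beyond \<open>q\<close>.
\<close>

lemma firm_minimal_in_wall_residue:
  assumes e: "e \<in> Ch" and firm: "descent (pos e) r" "\<And>s. descent (pos e) s \<Longrightarrow> s = r"
    and c: "wall_residue r e c" "descent (pos c) r"
  shows "len (pos e) \<le> len (pos c)"
proof -
  define J where "J = {t \<in> S. t \<otimes> r = r \<otimes> t}"
  have r: "r \<in> S" using firm(1) descent_letter by blast
  obtain q where q: "adj r q e" "\<not> descent (pos q) r" using gate_exists[OF base e firm(1)] by blast
  note qq = adj_chambers[OF q(1)]
  have pq: "pos q \<in> carrier W" using base qq by blast
  have nd: "\<not> descent (pos q) t" if "t \<in> J" for t
  proof (cases "t = r")
    case False
    then show ?thesis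
      using that descent_adj_commuting[OF base q(1), of t] firm(2)[of t] unfolding J_def by auto
  qed (use q in simp)
  have reach: "\<exists>v\<in>lists J. pos x = pos q \<otimes> wprod v" if "wall_residue r q x" for x
    using that unfolding wall_residue_def
  proof (induction rule: rtranclp_induct)
    case base
    show ?case using pq by (intro bexI[of _ "[]"]) auto
  next
    case (step x y)
    then obtain v where v: "v \<in> lists J" "pos x = pos q \<otimes> wprod v" by blast
    obtain t where t: "t \<in> J" "adj t x y"
      using step(2) adj_chambers(4) r unfolding J_def commuting_adj_def by fastforce
    have vS: "v \<in> lists S" "t \<in> S" using v(1) t(1) unfolding J_def by auto
    from delta_adj[OF based_ra_building.base[OF based_ra_building_axioms] t(2)] show ?case
    proof
      assume "pos y = pos x" then show ?thesis using v by metis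
    next
      assume "pos y = pos x \<otimes> t"
      then have "pos y = pos q \<otimes> wprod (v @ [t])" using v(2) pq vS by (simp add: m_assoc)
      then show ?thesis using v(1) t(1) by (intro bexI[of _ "v @ [t]"]) simp_all
    qed
  qed
  have cc: "c \<in> Ch" using wall_residue_chamber c(1) e by blast
  obtain x where x: "adj r x c" "\<not> descent (pos x) r" using gate_exists[OF base cc c(2)] by blast
  have "wall_residue r q x"
    using wall_residue_adj[OF q(1)] c(1) wall_residue_adj[OF adj_sym[OF x(1)]] wall_residue_trans
    by blast
  then obtain v where "v \<in> lists J" "pos x = pos q \<otimes> wprod v" using reach by blast
  then have "len (pos q) \<le> len (pos x)"
    using len_minimal_in_coset[OF pq _ nd, where J = J] unfolding J_def by auto
  then show ?thesis using gate_on_geodesic(2)[OF q] gate_on_geodesic(2)[OF x] by simp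
qed

text \<open>
  Recolour by swapping the colour of \<open>e\<close> with another colour that is not the gates' colour, for
  the letter \<open>r\<close> and only on the wall residue of \<open>e\<close>. A chamber whose coordinates change lies
  beyond some chamber of this residue with descent \<open>r\<close>, and \<open>e\<close> is closest to \<open>c0\<close> among those.
\<close>

lemma firm_moved:
  assumes thick: "thick S \<Delta>" and e: "e \<in> Ch" and firm: "firm W S (pos e)"
  obtains g where "g \<in> Aut \<Delta>" "\<And>c. c \<in> Ch \<Longrightarrow> len (pos c) < len (pos e) \<Longrightarrow> g c = c"
    "g e \<noteq> e" "\<And>c. c \<in> Ch \<Longrightarrow> pos (g c) = pos c"
proof -
  obtain r where r: "descent (pos e) r" "\<And>s. descent (pos e) s \<Longrightarrow> s = r"
    using firm firm_iff[of "pos e"] base e by blast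
  have rS: "r \<in> S" using r(1) descent_letter by blast
  obtain h where h: "colouring h" using colouring_exists .
  define y where "y = h r e"
  have y: "y \<in> panel r c0" "y \<noteq> c0"
    using colouring_range[OF h rS e] colouring_gate[OF h rS e] r(1) unfolding y_def by auto
  have "\<exists>a\<in>panel r c0. \<exists>b\<in>panel r c0. \<exists>c\<in>panel r c0. a \<noteq> b \<and> a \<noteq> c \<and> b \<noteq> c"
    using thick rS panel_in_panels[OF base] unfolding thick_def by blast
  then obtain z where z: "z \<in> panel r c0" "z \<noteq> c0" "z \<noteq> y" by metis
  define k where "k = h(r := \<lambda>c. if wall_residue r e c
    then Transposition.transpose y z (h r c) else h r c)"
  have k: "colouring k"
    unfolding colouring_def
  proof
    fix s assume s: "s \<in> S"
    have hs: "wall_colouring s (h s)" using h s unfolding colouring_def by blast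
    show "wall_colouring s (k s)"
    proof (cases "s = r")
      case True
      then show ?thesis using wall_colouring_swap[OF _ rS y(1) z(1) y(2) z(2), of "h r" e] hs
        by (simp add: k_def)
    qed (use hs in \<open>simp add: k_def\<close>)
  qed
  obtain g where g: "g \<in> Aut \<Delta>" "\<And>c. c \<in> Ch \<Longrightarrow> matched h k c (g c)"
    using recolouring_automorphism[OF h k] by blast
  have "matched h k c c" if "c \<in> Ch" "len (pos c) < len (pos e)" for c
    using that
  proof (induction rule: descent_chamber_induct)
    case root
    show ?case by (rule matched_base)
  next
    case (step c s f)
    note ff = adj_chambers[OF step(3)]
    have "len (pos f) < len (pos e)" using gate_on_geodesic(2)[OF step(3,4)] step(6) by simp
    then have m: "matched h k f f" using step(5) by blast
    have "h s f = c0" "k s f = c0"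
      using colouring_gate[OF h] colouring_gate[OF k] ff step(4) by auto
    moreover have "h s c = k s c"
    proof (cases "s = r")
      case True
      then have "\<not> wall_residue r e c"
        using firm_minimal_in_wall_residue[OF e r] step(2,6) by fastforce
      then show ?thesis using True by (simp add: k_def)
    qed (simp add: k_def)
    ultimately show ?case using matched_step[OF m step(3) step(3)] by blast
  qed
  then have "g c = c" if "c \<in> Ch" "len (pos c) < len (pos e)" for c
    using matched_functional[OF h k g(2)] that by blast
  moreover have "g e \<noteq> e"
  proof
    assume "g e = e"
    then have "k r e = h r e" using matched_colour[OF h k g(2)[OF e] rS] by simp
    moreover have "k r e = z" using wall_residue_refl by (simp add: k_def y_def)
    ultimately show False using z(3) y_def by simp
  qed
  moreover have "pos (g c) = pos c" if "c \<in> Ch" for c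
    using matched_pos[OF h k g(2)[OF that]] by simp
  ultimately show ?thesis using that g(1) by blast
qed

text \<open>
  Let \<open>e\<close> be the last but one chamber of a minimal gallery that ends in a fixed chamber. Then \<open>e\<close> is
  the gate of the last panel; this panel is preserved, and so is its gate.
\<close>

lemma fixed_downward_closed:
  assumes g: "g \<in> Aut \<Delta>" "\<And>x. x \<in> Ch \<Longrightarrow> pos (g x) = pos x"
    and "on_geodesic e c" "g c = c"
  shows "g e = e"
proof -
  obtain v where "path v e c" "len (pos c) = len (pos e) + length v"
    using assms(3) unfolding on_geodesic_def by blast
  then show ?thesis
  proof (induction v arbitrary: e)
    case Nil
    then show ?case using assms(4) by simp
  next
    case (Cons s v)
    then obtain d where d: "adj s e d" "path v d c" by auto
    note ch = adj_chambers[OF d(1)]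
    have "len (pos c) \<le> len (pos d) + length v" using len_delta_path[OF d(2) base] .
    then have gt: "len (pos e) < len (pos d)" using Cons.prems(2) by simp
    then have "pos d = pos e \<otimes> s" using delta_adj[OF base d(1)] by auto
    then have nd: "\<not> descent (pos e) s" using gt by (simp add: descent_def)
    have "g d = d"
      using Cons.IH[OF d(2)] gate_on_geodesic(2)[OF d(1) nd] Cons.prems(2) by simp
    then have a: "adj s (g e) d" using automorphism_adj[OF g(1) d(1)] by simp
    show ?case
    proof (rule ccontr)
      assume "g e \<noteq> e"
      then have "adj s e (g e)" using adj_trans[OF d(1) adj_sym[OF a]] by simp
      then have "descent (pos (g e)) s" using descent_after_ascent base nd by blast
      then show False using g(2) ch(1) nd by simp
    qed
  qed
qed

lemma fixed_chambers_eq_flexible: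
  assumes thick: "thick S \<Delta>"
  shows "fixed_chambers \<Delta> (pointwise_stabilizer (Aut \<Delta>) (ball n)) = flexible n"
proof (intro equalityI subsetI)
  fix c assume "c \<in> flexible n"
  then show "c \<in> fixed_chambers \<Delta> (pointwise_stabilizer (Aut \<Delta>) (ball n))"
    using flexible_fixed flexible_iff unfolding fixed_chambers_def pointwise_stabilizer_def by auto
next
  fix c assume "c \<in> fixed_chambers \<Delta> (pointwise_stabilizer (Aut \<Delta>) (ball n))"
  then have c: "c \<in> Ch"
    and fixed: "\<And>g. g \<in> Aut \<Delta> \<Longrightarrow> (\<And>x. x \<in> ball n \<Longrightarrow> g x = x) \<Longrightarrow> g c = c"
    unfolding fixed_chambers_def pointwise_stabilizer_def by auto
  have "\<not> firm W S (pos e)" if e: "on_geodesic e c" "n < len (pos e)" for e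
  proof
    assume firm: "firm W S (pos e)"
    have "e \<in> Ch" using on_geodesic_chambers[OF e(1)] by blast
    from firm_moved[OF thick this firm] obtain g where g: "g \<in> Aut \<Delta>"
      "\<And>c. c \<in> Ch \<Longrightarrow> len (pos c) < len (pos e) \<Longrightarrow> g c = c" "g e \<noteq> e"
      "\<And>c. c \<in> Ch \<Longrightarrow> pos (g c) = pos c" by blast
    have "g c = c" using fixed[OF g(1)] g(2) e(2) mem_ball_iff by simp
    then show False using fixed_downward_closed[OF g(1,4) e(1)] g(3) by blast
  qed
  then show "c \<in> flexible n" using c flexible_iff by blast
qed

section \<open>Boundedness\<close>

text \<open>
  Far away from \<open>c0\<close>, some minimal gallery passes through a firm chamber outside the ball.
\<close>

lemma flexible_near_base:
  assumes c: "c \<in> flexible n" shows "len (pos c) \<le> n * card S"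
proof (rule ccontr)
  assume "\<not> len (pos c) \<le> n * card S"
  have cc: "c \<in> Ch" using c flexible_iff by blast
  obtain u v where uv: "reduced (u @ v)" "wprod (u @ v) = pos c" "n < length u" "firm W S (wprod u)"
    using long_has_firm_prefix[of "pos c" n] base cc \<open>\<not> _\<close> by (auto simp: not_le)
  then have "path (u @ v) c0 c" using delta_iff_path[OF uv(1) base cc] by simp
  then obtain e where e: "path u c0 e" "path v e c" using path_append by blast
  have u: "reduced u" using reduced_prefix uv(1) by blast
  then have pe: "pos e = wprod u" "len (pos e) = length u" using delta_path e(1) reduced_length by auto
  then have "on_geodesic e c"
    unfolding on_geodesic_def using e(2) reduced_length[OF uv(1)] uv(2) by (intro exI[of _ v]) simp
  then show False using c uv pe unfolding flexible_iff by auto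
qed

lemma flexible_bounded: "bounded_chambers W S \<delta> (flexible n)"
  unfolding bounded_chambers_def gallery_dist_def
proof (intro exI ballI)
  fix c d assume c: "c \<in> flexible n" and d: "d \<in> flexible n"
  have ch: "c \<in> Ch" "d \<in> Ch" using c d flexible_iff by auto
  obtain u where u: "reduced u" "wprod u = pos c" "path u c0 c"
    using reduced_path_exists[OF base ch(1)] .
  obtain v where v: "reduced v" "wprod v = pos d" "path v c0 d"
    using reduced_path_exists[OF base ch(2)] .
  have "path (rev u @ v) c d" using path_rev u(3) v(3) path_append by blast
  then have "len (\<delta> c d) \<le> length u + length v" using len_delta_le by fastforce
  also have "length u = len (pos c)" using reduced_length u by metis
  also have "length v = len (pos d)" using reduced_length v by metis
  finally show "len (\<delta> c d) \<le> n * card S + n * card S"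
    using flexible_near_base c d by (meson add_mono le_trans)
qed

end

theorem theorem4p4:
  fixes W :: "('w, 'x) monoid_scheme" and S :: "'w set"
    and \<Delta> :: "('c, 'w) coloured_graph" and \<delta> :: "'c \<Rightarrow> 'c \<Rightarrow> 'w"
    and c0 :: 'c and n :: nat
  assumes "right_angled_building W S \<Delta> \<delta>"
    and "thick S \<Delta>"
    and "semi_regular S \<Delta>"
    and "c0 \<in> chambers \<Delta>"
  shows "let K = pointwise_stabilizer (Aut \<Delta>) (chamber_ball W S \<Delta> \<delta> c0 n)
    in fixed_chambers \<Delta> K = Flex W S \<Delta> \<delta> c0 n
       \<and> bounded_chambers W S \<delta> (Flex W S \<Delta> \<delta> c0 n)"
proof -
  interpret based_ra_building W S \<Delta> \<delta> c0
    using assms by unfold_locales (auto simp: right_angled_building_def)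
  show ?thesis
    using fixed_chambers_eq_flexible[OF assms(2)] flexible_bounded by (simp add: Let_def)
qed

end
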